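(* Let $\kappa>0$ and $h>0$. Let $A\ge 0$ be a random variable with $\mathbf{E}A^\kappa=1$ and $\mathbf{E}[A^\kappa\log_+A]<\infty$, such that the distribution of $\log A$ conditioned on $A\neq 0$ is arithmetic with span $h$. Let $X$ be a real random variable independent of $A$ such that $$\int_0^\infty y^{\kappa-1}\,\big|\mathbf{P}\{X>y\}-\mathbf{P}\{AX>y\}\big|\,\mathrm{d}y<\infty .$$ Then there exists a function $q\in\mathcal{Q}_{\kappa,h}$ such that for every $x\in C_q$ $$\lim_{n\to\infty}x^\kappa e^{\kappa nh}\,\mathbf{P}\{X>xe^{nh}\}=q(x).\qquad( * )$$ Moreover, if $$\sum_{j\in\mathbb{Z}}e^{\kappa(x+jh)}\big|\mathbf{P}\{X>e^{x+jh}\}-\mathbf{P}\{AX>e^{x+jh}\}\big|<\infty\quad\text{for each }x\in\mathbb{R},$$ then $( * )$ holds for all $x>0$.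
   Context: A random variable $Y$ (or its distribution) is arithmetic if $Y\in h\mathbb{Z}$ a.s. for some $h>0$; the largest such $h$ is the span of $Y$. $\log_+ a=\max\{\log a,0\}$, with $0^\kappa\log_+0=0$. For $\kappa,h>0$, $\mathcal{Q}_{\kappa,h}$ denotes the set of functions $q:(0,\infty)\to[0,\infty)$ such that $x^{-\kappa}q(x)$ is nonincreasing and $q(xe^h)=q(x)$ for all $x>0$. For a real function $q$, $C_q$ denotes the set of its continuity points. *)

theory Defs
  imports "HOL-Probability.Probability"
begin

definition lattice_points :: "real \<Rightarrow> real set" where
  "lattice_points h = range (\<lambda>k::int. h * of_int k)"

text \<open>Distributions are Borel measures on the reals. A point mass at 0 is arithmetic but has
  no span, since the set below is then unbounded; this is why the span is a relation.\<close>

definition arithmetic_steps :: "real measure \<Rightarrow> real set" where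
  "arithmetic_steps \<mu> = {h. 0 < h \<and> (AE y in \<mu>. y \<in> lattice_points h)}"

definition arithmetic :: "real measure \<Rightarrow> bool" where
  "arithmetic \<mu> \<longleftrightarrow> arithmetic_steps \<mu> \<noteq> {}"

definition has_arithmetic_span :: "real measure \<Rightarrow> real \<Rightarrow> bool" where
  "has_arithmetic_span \<mu> h \<longleftrightarrow>
     h \<in> arithmetic_steps \<mu> \<and> (\<forall>h'\<in>arithmetic_steps \<mu>. h' \<le> h)"

definition cond_log_distr :: "'a measure \<Rightarrow> ('a \<Rightarrow> real) \<Rightarrow> real measure" where
  "cond_log_distr M A =
     distr (uniform_measure M {\<omega> \<in> space M. A \<omega> \<noteq> 0}) borel (\<lambda>\<omega>. ln (A \<omega>))"

text \<open>The convention \<open>0\<^sup>\<kappa> log\<^sub>+ 0 = 0\<close> holds automatically, as \<open>0 powr \<kappa> = 0\<close> in HOL.\<close>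

definition log_plus :: "real \<Rightarrow> real" where
  "log_plus a = max (ln a) 0"

text \<open>A function on \<open>(0,\<infinity>)\<close> is a total function on the reals of which only the values
  on \<open>{0<..}\<close> are constrained.\<close>

definition Q_class :: "real \<Rightarrow> real \<Rightarrow> (real \<Rightarrow> real) set" where
  "Q_class \<kappa> h = {q. (\<forall>x>0. 0 \<le> q x) \<and>
     antimono_on {0<..} (\<lambda>x. x powr (-\<kappa>) * q x) \<and>
     (\<forall>x>0. q (x * exp h) = q x)}"

definition continuity_points :: "real set \<Rightarrow> (real \<Rightarrow> real) \<Rightarrow> real set" where
  "continuity_points S q = {x \<in> S. continuous (at x within S) q}"

end

theory Submission
  imports Defs "HOL-Complex_Analysis.Great_Picard"
begin

text \<open>
  Reweighting by \<open>A\<^sup>\<kappa>\<close> turns \<open>Z = log A / h\<close> into an integer random variable whose support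
  generates \<open>\<int>\<close>. For fixed \<open>x\<close>, the sequence \<open>r j = exp (\<kappa>jh) P(X > x exp (jh))\<close> then satisfies the
  two-sided renewal equation \<open>r = f + E[r (\<cdot> - Z)]\<close>, where \<open>f\<close> is the summand of the tail-difference
  series. Since \<open>E[A\<^bsup>\<kappa>/2\<^esup>] < 1\<close>, the random walk with steps \<open>Z\<close> has a Green function that decays
  exponentially at \<open>-\<infinity>\<close>, and iterating the equation gives \<open>r = green * f\<close>. The renewal theorem for
  the Green function follows from the triviality of bounded harmonic functions (Choquet and Deny),
  and dominated convergence gives a limit of \<open>r\<close> at \<open>\<infinity>\<close> whenever \<open>f\<close> is summable. The integral
  hypothesis makes \<open>f\<close> summable for a dense set of \<open>x\<close>; at every \<open>x\<close>, \<open>q x\<close> is defined by the lower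
  limit, and monotonicity of tails gives convergence at its continuity points.
\<close>

section \<open>Bounded harmonic functions on the integers\<close>

lemma pmf_times_le_integral:
  fixes f :: "'a \<Rightarrow> real"
  assumes "integrable (measure_pmf p) f" "\<And>x. 0 \<le> f x"
  shows "pmf p a * f a \<le> (\<integral>x. f x \<partial>measure_pmf p)"
proof -
  have "pmf p a * f a = (\<integral>x. f a * indicator {a} x \<partial>measure_pmf p)"
    by (simp add: measure_pmf_single mult.commute)
  also have "\<dots> \<le> (\<integral>x. f x \<partial>measure_pmf p)"
  proof (rule integral_mono)
    show "integrable (measure_pmf p) (\<lambda>x. f a * indicator {a} x)"
      by (rule measure_pmf.integrable_const_bound[where B = "\<bar>f a\<bar>"]) (auto simp: indicator_def)
  qed (use assms in \<open>auto simp: indicator_def\<close>)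
  finally show ?thesis .
qed

lemma integrable_pmf_bounded:
  fixes f :: "'a \<Rightarrow> real"
  assumes "\<And>x. \<bar>f x\<bar> \<le> B"
  shows "integrable (measure_pmf p) f"
  by (rule measure_pmf.integrable_const_bound[where B = B]) (auto simp: assms)

text \<open>Otherwise \<open>w i = v i - v (i - d)\<close> has a positive supremum; harmonicity propagates a near-maximum
  of \<open>w\<close> along \<open>i, i - d, i - 2d, \<dots>\<close>, and summing these values contradicts the bound on \<open>v\<close>.\<close>

lemma harmonic_diff_nonpos:
  fixes p :: "int pmf" and v :: "int \<Rightarrow> real"
  assumes bdd: "\<And>i. \<bar>v i\<bar> \<le> B"
    and harm: "\<And>i. v i = (\<integral>k. v (i - k) \<partial>measure_pmf p)"
    and d: "d \<in> set_pmf p"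
  shows "v i \<le> v (i - d)"
proof (rule ccontr)
  define w where "w i = v i - v (i - d)" for i
  define S where "S = (SUP i. w i)"
  define c where "c = pmf p d"
  assume "\<not> v i \<le> v (i - d)"
  then have w_pos: "w i > 0" by (simp add: w_def)
  have w_le: "w i \<le> 2 * B" for i
    using bdd[of i] bdd[of "i - d"] by (simp add: w_def abs_le_iff)
  then have bdd_w: "bdd_above (range w)" by (meson bdd_aboveI2)
  have w_le_S: "w i \<le> S" for i
    unfolding S_def using cSUP_upper[of i UNIV w, OF UNIV_I bdd_w] .
  have S: "S > 0" using w_pos w_le_S[of i] by simp
  have c: "c > 0" using d by (simp add: c_def pmf_positive_iff)
  have int_v: "integrable (measure_pmf p) (\<lambda>k. v (j - k))" for j
    using bdd by (intro integrable_pmf_bounded[where B = B]) auto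
  have int_w: "integrable (measure_pmf p) (\<lambda>k. w (j - k))" for j
    using int_v[of j] int_v[of "j - d"] unfolding w_def by (auto simp: algebra_simps)
  have w_harm: "w j = (\<integral>k. w (j - k) \<partial>measure_pmf p)" for j
    unfolding w_def using int_v[of j] int_v[of "j - d"] harm[of j] harm[of "j - d"]
    by (subst Bochner_Integration.integral_diff) (auto simp: algebra_simps)
  \<comment> \<open>The nonnegative function \<open>S - w (j - k)\<close> of \<open>k\<close> has
    mean \<open>S - w j\<close>, at most \<open>e\<close>. The atom at \<open>d\<close> has mass
    \<open>c\<close>, so the value there is at most \<open>e / c\<close>.\<close>
  have step: "w (j - d) \<ge> S - e / c" if "w j \<ge> S - e" for j e
  proof -
    have "c * (S - w (j - d)) \<le> (\<integral>k. S - w (j - k) \<partial>measure_pmf p)"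
      unfolding c_def using int_w w_le_S by (intro pmf_times_le_integral) auto
    also have "\<dots> = S - w j"
      using int_w w_harm[of j] by (subst Bochner_Integration.integral_diff) auto
    finally have "c * (S - w (j - d)) \<le> e" using that by simp
    then show ?thesis using c by (simp add: field_simps)
  qed
  have iter: "w (j - of_nat m * d) \<ge> S - e / c ^ m" if "w j \<ge> S - e" for j e m
  proof (induction m)
    case (Suc m)
    from step[OF this] show ?case by (simp add: algebra_simps)
  qed (use that in simp)
  \<comment> \<open>\<open>n\<close> is large enough that \<open>n\<close> increments of size
    \<open>S / 2\<close> exceed \<open>2 * B\<close>, the largest possible difference of two values
    of \<open>v\<close>. The initial deficit \<open>e\<close> below is small enough that dividing it
    by \<open>c\<close> fewer than \<open>n\<close> times leaves at most
    \<open>S / 2\<close>.\<close>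
  obtain n :: nat where n: "real n > 4 * B / S" using reals_Archimedean2 by blast
  define e where "e = c ^ n * S / 2"
  have e: "e > 0" using c S by (simp add: e_def)
  obtain j where "w j > S - e"
  proof -
    have "\<exists>x\<in>range w. S - e < x"
      unfolding S_def by (rule less_cSupD) (use e in \<open>auto simp: S_def\<close>)
    then show ?thesis using that by blast
  qed
  then have j: "w (j - of_nat m * d) \<ge> S / 2" if "m < n" for m
  proof -
    have "e / c ^ m \<le> S / 2"
    proof -
      have "c ^ n \<le> c ^ m" using c that by (intro power_decreasing) (auto simp: c_def pmf_le_1)
      then show ?thesis using c S by (simp add: e_def field_simps)
    qed
    then show ?thesis using iter[of e j m] \<open>w j > S - e\<close> by linarith
  qed
  have "v j - v (j - of_nat n * d) = (\<Sum>m<n. w (j - of_nat m * d))"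
    unfolding w_def
    using sum_lessThan_telescope'[of "\<lambda>m. v (j - of_nat m * d)" n]
    by (simp add: algebra_simps)
  also have "\<dots> \<ge> (\<Sum>m<n. S / 2)" using j by (intro sum_mono) auto
  finally have "real n * S / 2 \<le> 2 * B"
    using bdd[of j] bdd[of "j - of_nat n * d"] by (simp add: abs_le_iff)
  then show False using n S by (simp add: field_simps)
qed

text \<open>Bounded harmonic functions are closed under negation, so the one-sided inequality for
  \<open>v\<close> and for \<open>- v\<close> gives equality.\<close>

lemma harmonic_periodic:
  fixes p :: "int pmf" and v :: "int \<Rightarrow> real"
  assumes bdd: "\<And>i. \<bar>v i\<bar> \<le> B"
    and harm: "\<And>i. v i = (\<integral>k. v (i - k) \<partial>measure_pmf p)"
    and d: "d \<in> set_pmf p"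
  shows "v (i - d) = v i"
proof (rule antisym)
  show "v i \<le> v (i - d)" by (rule harmonic_diff_nonpos[OF assms])
  show "v (i - d) \<le> v i"
  proof -
    have "- v i \<le> - v (i - d)"
    proof (rule harmonic_diff_nonpos[where v = "\<lambda>i. - v i", OF _ _ d])
      show "\<bar>- v j\<bar> \<le> B" for j using bdd[of j] by simp
      show "- v j = (\<integral>k. - v (j - k) \<partial>measure_pmf p)" for j
        by (subst Bochner_Integration.integral_minus) (metis harm)
    qed
    then show ?thesis by simp
  qed
qed

text \<open>The periods of \<open>v\<close> form a subgroup \<open>H\<close> of the integers.
  Division with remainder by its least positive element \<open>g\<close> shows that \<open>g\<close>
  divides all of \<open>D\<close>, so the gcd condition forces \<open>g = 1\<close>.\<close>

lemma periods_trivial: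
  fixes v :: "int \<Rightarrow> 'a"
  assumes per: "\<And>d i. d \<in> D \<Longrightarrow> v (i - d) = v i" and Gcd: "Gcd D = 1"
  shows "v i = v 0"
proof -
  define H where "H = {d. \<forall>i. v (i - d) = v i}"
  have D: "D \<subseteq> H" using per by (auto simp: H_def)
  have diff: "a - b \<in> H" if "a \<in> H" "b \<in> H" for a b
  proof -
    have "v (i - (a - b)) = v i" for i
    proof -
      have "v (i - (a - b) - b) = v (i - (a - b))" using that(2) unfolding H_def by blast
      moreover have "v (i - a) = v i" using that(1) unfolding H_def by blast
      ultimately show ?thesis by simp
    qed
    then show ?thesis by (simp add: H_def)
  qed
  have zero: "0 \<in> H" by (simp add: H_def)
  have minus: "- a \<in> H" if "a \<in> H" for a using diff[OF zero that] by simp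
  have plus: "a + b \<in> H" if "a \<in> H" "b \<in> H" for a b using diff[OF that(1) minus[OF that(2)]] by simp
  have mult_nat: "of_nat n * a \<in> H" if "a \<in> H" for a n
    by (induction n) (auto simp: zero algebra_simps intro: plus that)
  have mult: "m * a \<in> H" if "a \<in> H" for a m
  proof (cases "m \<ge> 0")
    case True
    then show ?thesis using mult_nat[OF that, of "nat m"] by simp
  next
    case False
    then show ?thesis using minus[OF mult_nat[OF that, of "nat (- m)"]] by simp
  qed
  have "\<exists>d. d > 0 \<and> d \<in> H"
  proof -
    have "\<not> D \<subseteq> {0}" using Gcd Gcd_0_iff by (metis zero_neq_one)
    then obtain a where "a \<in> D" "a \<noteq> 0" by blast
    then have "\<bar>a\<bar> > 0 \<and> \<bar>a\<bar> \<in> H" using D minus by (auto simp: abs_if)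
    then show ?thesis by blast
  qed
  then have ex: "\<exists>n::nat. n > 0 \<and> int n \<in> H" by (metis zero_less_imp_eq_int of_nat_0_less_iff)
  define g where "g = (LEAST n::nat. n > 0 \<and> int n \<in> H)"
  have g: "g > 0" "int g \<in> H" using LeastI_ex[OF ex] by (auto simp: g_def)
  have "int g dvd a" if "a \<in> D" for a
  proof -
    have "a mod int g = a - (a div int g) * int g" by (simp add: minus_div_mult_eq_mod)
    then have r: "a mod int g \<in> H" using diff mult g D that by auto
    define n where "n = nat (a mod int g)"
    have n: "int n = a mod int g" using g(1) by (simp add: n_def)
    moreover have "int n < int g" unfolding n using g(1) by (intro pos_mod_bound) simp
    ultimately have "\<not> n > 0"
      using not_less_Least[of n "\<lambda>n. n > 0 \<and> int n \<in> H"] r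
      unfolding g_def[symmetric] by auto
    then show ?thesis using n by (simp add: dvd_eq_mod_eq_0)
  qed
  then have "int g dvd Gcd D" by (rule Gcd_greatest)
  then have "g = 1" using Gcd by simp
  then have "i \<in> H" using mult[OF g(2), of i] by simp
  then have "v (i - i) = v i" unfolding H_def by blast
  then show ?thesis by simp
qed

lemma harmonic_constant:
  fixes p :: "int pmf" and v :: "int \<Rightarrow> real"
  assumes "\<And>i. \<bar>v i\<bar> \<le> B" "\<And>i. v i = (\<integral>k. v (i - k) \<partial>measure_pmf p)" "Gcd (set_pmf p) = 1"
  shows "v i = v 0"
proof (rule periods_trivial[of "set_pmf p" v])
  show "v (j - d) = v j" if "d \<in> set_pmf p" for d j
    using harmonic_periodic[of v B p d j] assms that by blast
qed (fact assms(3))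

section \<open>The renewal theorem for transient integer walks\<close>

text \<open>The recursion draws the first step separately, so that \<open>pmf_walk_Suc\<close> is a
  first-step decomposition of the same form as the renewal equation.\<close>

primrec walk :: "int pmf \<Rightarrow> nat \<Rightarrow> int pmf" where
  "walk p 0 = return_pmf 0"
| "walk p (Suc n) = bind_pmf p (\<lambda>k. map_pmf (\<lambda>s. k + s) (walk p n))"

lemma pmf_walk_Suc: "pmf (walk p (Suc n)) j = (\<integral>k. pmf (walk p n) (j - k) \<partial>measure_pmf p)"
proof -
  have "pmf (map_pmf (\<lambda>s. k + s) (walk p n)) j = pmf (walk p n) (j - k)" for k
    using pmf_map_inj'[of "\<lambda>s. k + s" "walk p n" "j - k"] by (simp add: inj_on_def)
  then show ?thesis by (simp add: pmf_bind)
qed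

text \<open>The exponential moment below 1 is the quantitative form of drift to the right: it makes
  sums over time geometric, with no recurrence analysis.\<close>

locale transient_walk =
  fixes p :: "int pmf" and l \<rho> :: real
  assumes l_pos: "l > 0"
    and integrable_exp: "integrable (measure_pmf p) (\<lambda>k. exp (- l * of_int k))"
    and expectation_exp: "(\<integral>k. exp (- l * of_int k) \<partial>measure_pmf p) = \<rho>"
    and rho_less_1: "\<rho> < 1"
begin

lemma rho_nonneg: "\<rho> \<ge> 0"
  unfolding expectation_exp[symmetric] by (intro Bochner_Integration.integral_nonneg) simp

text \<open>A Chernoff bound for a single atom: each first-step average of
  \<open>exp (l * (j - k))\<close> reproduces \<open>exp (l * j)\<close> and gains one factor
  \<open>\<rho>\<close>.\<close>

lemma pmf_walk_le: "pmf (walk p n) j \<le> \<rho> ^ n * exp (l * of_int j)"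
proof (induction n arbitrary: j)
  case 0
  then show ?case by (cases "j = 0") auto
next
  case (Suc n)
  have e: "\<rho> ^ n * exp (l * of_int (j - k)) = \<rho> ^ n * exp (l * of_int j) * exp (- l * of_int k)" for k
    by (simp add: exp_add[symmetric] algebra_simps)
  have "pmf (walk p (Suc n)) j \<le> (\<integral>k. \<rho> ^ n * exp (l * of_int j) * exp (- l * of_int k) \<partial>measure_pmf p)"
    unfolding pmf_walk_Suc
  proof (rule integral_mono)
    show "integrable (measure_pmf p) (\<lambda>k. pmf (walk p n) (j - k))"
      by (rule integrable_pmf_bounded[where B = 1]) (simp add: pmf_le_1)
    show "integrable (measure_pmf p) (\<lambda>k. \<rho> ^ n * exp (l * of_int j) * exp (- l * of_int k))"
      using integrable_exp by (rule integrable_mult_right)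
    show "pmf (walk p n) (j - k) \<le> \<rho> ^ n * exp (l * of_int j) * exp (- l * of_int k)" for k
      using Suc.IH[of "j - k"] unfolding e .
  qed
  also have "\<dots> = \<rho> ^ Suc n * exp (l * of_int j)"
    by (subst integral_mult_right_zero) (simp only: expectation_exp power_Suc mult_ac)
  finally show ?case .
qed

section \<open>The Green function: bounds, maximum principle and renewal equation\<close>

definition green :: "int \<Rightarrow> real" where
  "green j = (\<Sum>n. pmf (walk p n) j)"

lemma summable_walk: "summable (\<lambda>n. pmf (walk p n) j)"
proof (rule summable_comparison_test')
  show "summable (\<lambda>n. \<rho> ^ n * exp (l * of_int j))"
    using rho_nonneg rho_less_1 by (intro summable_mult2 summable_geometric) simp
  show "norm (pmf (walk p n) j) \<le> \<rho> ^ n * exp (l * of_int j)" if "n \<ge> 0" for n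
    using pmf_walk_le[of n j] by simp
qed

lemma green_nonneg: "green j \<ge> 0"
  unfolding green_def by (intro suminf_nonneg summable_walk) simp

lemma green_le_exp: "green j \<le> exp (l * of_int j) / (1 - \<rho>)"
proof -
  have "green j \<le> (\<Sum>n. \<rho> ^ n * exp (l * of_int j))"
    unfolding green_def using rho_nonneg rho_less_1
    by (intro suminf_le pmf_walk_le summable_walk summable_mult2 summable_geometric) simp
  also have "\<dots> = (\<Sum>n. \<rho> ^ n) * exp (l * of_int j)"
    using rho_nonneg rho_less_1 by (intro suminf_mult2[symmetric] summable_geometric) simp
  also have "\<dots> = exp (l * of_int j) / (1 - \<rho>)"
    using rho_nonneg rho_less_1 by (simp add: suminf_geometric)
  finally show ?thesis .
qed

lemma partial_green_le: "(\<Sum>m<n. pmf (walk p m) j) \<le> green j"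
  unfolding green_def by (intro sum_le_suminf summable_walk) auto

lemma partial_green_tendsto: "(\<lambda>n. \<Sum>m<n. pmf (walk p m) j) \<longlonglongrightarrow> green j"
  unfolding green_def by (rule summable_LIMSEQ[OF summable_walk])

lemma partial_green_Suc:
  "(\<Sum>m<Suc n. pmf (walk p m) j) =
     of_bool (j = 0) + (\<integral>k. (\<Sum>m<n. pmf (walk p m) (j - k)) \<partial>measure_pmf p)"
proof -
  have "(\<integral>k. (\<Sum>m<n. pmf (walk p m) (j - k)) \<partial>measure_pmf p) = (\<Sum>m<n. pmf (walk p (Suc m)) j)"
    unfolding pmf_walk_Suc
    by (intro Bochner_Integration.integral_sum integrable_pmf_bounded[where B = 1]) (simp add: pmf_le_1)
  then show ?thesis
    by (subst sum.lessThan_Suc_shift) (auto simp: indicator_def)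
qed

text \<open>A maximum principle. Away from the origin the sum of \<open>n + 1\<close> terms is, by
  \<open>partial_green_Suc\<close>, an average of sums of \<open>n\<close> terms, to which the
  induction hypothesis applies. In the limit, \<open>green 0\<close> is a uniform bound and serves
  as dominating constant from here on.\<close>

lemma partial_green_le_0: "(\<Sum>m<n. pmf (walk p m) j) \<le> (\<Sum>m<n. pmf (walk p m) 0)"
proof (induction n arbitrary: j)
  case (Suc n)
  show ?case
  proof (cases "j = 0")
    case False
    have "(\<Sum>m<Suc n. pmf (walk p m) j) = (\<integral>k. (\<Sum>m<n. pmf (walk p m) (j - k)) \<partial>measure_pmf p)"
      using False by (subst partial_green_Suc) simp
    also have "\<dots> \<le> (\<integral>k. (\<Sum>m<n. pmf (walk p m) 0) \<partial>measure_pmf p)"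
    proof (rule integral_mono)
      show "integrable (measure_pmf p) (\<lambda>k. \<Sum>m<n. pmf (walk p m) (j - k))"
        by (intro Bochner_Integration.integrable_sum integrable_pmf_bounded[where B = 1])
          (simp add: pmf_le_1)
    qed (use Suc.IH in auto)
    also have "\<dots> \<le> (\<Sum>m<Suc n. pmf (walk p m) 0)" by simp
    finally show ?thesis .
  qed simp
qed simp

lemma green_le_0: "green j \<le> green 0"
  by (rule LIMSEQ_le[OF partial_green_tendsto partial_green_tendsto])
    (use partial_green_le_0 in blast)

lemma abs_green_le: "\<bar>green j\<bar> \<le> green 0"
  using green_nonneg[of j] green_le_0[of j] by simp

lemma integrable_green: "integrable (measure_pmf p) (\<lambda>k. green (j - k))"
  by (rule integrable_pmf_bounded[OF abs_green_le])

lemma green_renewal: "green j = of_bool (j = 0) + (\<integral>k. green (j - k) \<partial>measure_pmf p)"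
proof (rule LIMSEQ_unique)
  show "(\<lambda>n. \<Sum>m<Suc n. pmf (walk p m) j) \<longlonglongrightarrow> green j"
    using partial_green_tendsto by (rule LIMSEQ_Suc)
  show "(\<lambda>n. \<Sum>m<Suc n. pmf (walk p m) j) \<longlonglongrightarrow>
      of_bool (j = 0) + (\<integral>k. green (j - k) \<partial>measure_pmf p)"
    unfolding partial_green_Suc
  proof (intro tendsto_intros integral_dominated_convergence[where w = "\<lambda>_. green 0"] AE_I2)
    show "(\<lambda>n. \<Sum>m<n. pmf (walk p m) (j - k)) \<longlonglongrightarrow> green (j - k)" for k
      by (rule partial_green_tendsto)
    show "norm (\<Sum>m<n. pmf (walk p m) (j - k)) \<le> green 0" for n k
      using partial_green_le[of "j - k" n] green_le_0[of "j - k"]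
      by (simp add: sum_nonneg)
  qed auto
qed

text \<open>Summation by parts of the renewal equation: \<open>\<psi>\<close> is an antidifference of \<open>green\<close>, and
  \<open>W n = E[\<psi> n - \<psi> (n - Z)]\<close> satisfies \<open>W n - W (n - 1) = of_bool (n = 0)\<close>.\<close>

definition \<psi> :: "int \<Rightarrow> real" where
  "\<psi> n = (\<Sum>i\<in>{1..n}. green i) - (\<Sum>i\<in>{n+1..0}. green i)"

lemma psi_diff: "\<psi> n - \<psi> (n - 1) = green n"
proof (cases "n \<ge> 1")
  case True
  then have "{1..n} = insert n {1..n-1}" by auto
  then show ?thesis using True by (simp add: \<psi>_def)
next
  case False
  then have "{n..0} = insert n {n+1..0}" by auto
  then show ?thesis using False by (simp add: \<psi>_def)
qed

text \<open>The increment is a signed sum of \<open>\<bar>k\<bar>\<close> values of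
  \<open>green\<close>. Linear growth in \<open>k\<close> means that a finite first moment of the
  step suffices to dominate the integrand of \<open>W\<close>.\<close>

lemma psi_increment_le: "\<bar>\<psi> n - \<psi> (n - k)\<bar> \<le> \<bar>of_int k\<bar> * green 0"
proof (induction k rule: int_induct[where k = 0])
  case (step1 k)
  have "\<psi> n - \<psi> (n - (k + 1)) = \<psi> n - \<psi> (n - k) + green (n - k)"
    using psi_diff[of "n - k"] by (simp add: algebra_simps)
  then show ?case using step1 abs_green_le[of "n - k"] by (simp add: algebra_simps)
next
  case (step2 k)
  have "\<psi> n - \<psi> (n - (k - 1)) = \<psi> n - \<psi> (n - k) - green (n - k + 1)"
    using psi_diff[of "n - k + 1"] by (simp add: algebra_simps)
  then show ?case using step2 abs_green_le[of "n - k + 1"] by (simp add: algebra_simps)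
qed simp

lemma psi_increment_tendsto:
  assumes "\<And>i. ((\<lambda>m. green (s m + i)) \<longlongrightarrow> c) F"
  shows "((\<lambda>m. \<psi> (s m) - \<psi> (s m - k)) \<longlongrightarrow> of_int k * c) F"
proof (induction k rule: int_induct[where k = 0])
  case (step1 k)
  have e: "\<psi> n - \<psi> (n - (k + 1)) = \<psi> n - \<psi> (n - k) + green (n + (- k))" for n
    using psi_diff[of "n - k"] by (simp add: algebra_simps)
  show ?case unfolding e using tendsto_add[OF step1(2) assms[of "- k"]] by (simp add: algebra_simps)
next
  case (step2 k)
  have e: "\<psi> n - \<psi> (n - (k - 1)) = \<psi> n - \<psi> (n - k) - green (n + (1 - k))" for n
    using psi_diff[of "n - k + 1"] by (simp add: algebra_simps)
  show ?case unfolding e using tendsto_diff[OF step2(2) assms[of "1 - k"]] by (simp add: algebra_simps)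
qed simp

end

section \<open>The renewal constant for aperiodic walks with finite mean step\<close>

locale renewal_walk = transient_walk +
  assumes integrable_step: "integrable (measure_pmf p) real_of_int"
    and aperiodic: "Gcd (set_pmf p) = 1"
begin

definition W :: "int \<Rightarrow> real" where
  "W n = (\<integral>k. \<psi> n - \<psi> (n - k) \<partial>measure_pmf p)"

lemma integrable_psi: "integrable (measure_pmf p) (\<lambda>k. \<psi> n - \<psi> (n - k))"
proof (rule Bochner_Integration.integrable_bound)
  show "integrable (measure_pmf p) (\<lambda>k. \<bar>real_of_int k\<bar> * green 0)"
    using integrable_step by (intro integrable_mult_left integrable_abs)
qed (use psi_increment_le green_nonneg in \<open>auto simp: abs_mult\<close>)

text \<open>This ties any limit of translates of \<open>green\<close> to the mean step: if they all
  tend to \<open>c\<close>, the increment of \<open>\<psi>\<close> over \<open>k\<close> sites tends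
  to \<open>k * c\<close>, and averaging over \<open>k\<close> gives the mean times
  \<open>c\<close>.\<close>

lemma W_tendsto:
  assumes "\<And>i. (\<lambda>m. green (s m + i)) \<longlonglongrightarrow> c"
  shows "(\<lambda>m. W (s m)) \<longlonglongrightarrow> (\<integral>k. of_int k \<partial>measure_pmf p) * c"
proof -
  have "(\<lambda>m. W (s m)) \<longlonglongrightarrow> (\<integral>k. of_int k * c \<partial>measure_pmf p)"
    unfolding W_def
  proof (rule integral_dominated_convergence[where w = "\<lambda>k. \<bar>real_of_int k\<bar> * green 0"])
    show "integrable (measure_pmf p) (\<lambda>k. \<bar>real_of_int k\<bar> * green 0)"
      using integrable_step by (intro integrable_mult_left integrable_abs)
  qed (use psi_increment_tendsto[of s c, OF assms] psi_increment_le in auto)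
  then show ?thesis by simp
qed

lemma W_diff: "W n - W (n - 1) = of_bool (n = 0)"
proof -
  have "W n - W (n - 1) = (\<integral>k. (\<psi> n - \<psi> (n - k)) - (\<psi> (n - 1) - \<psi> (n - 1 - k)) \<partial>measure_pmf p)"
    unfolding W_def by (intro Bochner_Integration.integral_diff[symmetric] integrable_psi)
  also have "\<dots> = (\<integral>k. green n - green (n - k) \<partial>measure_pmf p)"
  proof (rule Bochner_Integration.integral_cong[OF refl])
    fix k
    show "(\<psi> n - \<psi> (n - k)) - (\<psi> (n - 1) - \<psi> (n - 1 - k)) = green n - green (n - k)"
      using psi_diff[of n] psi_diff[of "n - k"] by (simp add: algebra_simps)
  qed
  also have "\<dots> = green n - (\<integral>k. green (n - k) \<partial>measure_pmf p)"
    by (subst Bochner_Integration.integral_diff) (auto simp: integrable_green)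
  also have "\<dots> = of_bool (n = 0)" using green_renewal[of n] by simp
  finally show ?thesis .
qed

lemma green_at_bot: "(\<lambda>m. green (- int m + i)) \<longlonglongrightarrow> 0"
proof (rule tendsto_sandwich[OF _ _ tendsto_const])
  have "(\<lambda>m. exp (l * of_int i) / (1 - \<rho>) * exp (- l) ^ m) \<longlonglongrightarrow> exp (l * of_int i) / (1 - \<rho>) * 0"
    using l_pos by (intro tendsto_intros LIMSEQ_realpow_zero) auto
  then show "(\<lambda>m. exp (l * of_int i) / (1 - \<rho>) * exp (- l) ^ m) \<longlonglongrightarrow> 0" by simp
  have "green (- int m + i) \<le> exp (l * of_int i) / (1 - \<rho>) * exp (- l) ^ m" for m
    using green_le_exp[of "- int m + i"]
    by (simp add: exp_of_nat_mult[symmetric] exp_add[symmetric] algebra_simps flip: times_divide_eq_left)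
  then show "\<forall>\<^sub>F m in sequentially. green (- int m + i) \<le> exp (l * of_int i) / (1 - \<rho>) * exp (- l) ^ m"
    by simp
qed (auto simp: green_nonneg)

text \<open>By \<open>W_diff\<close>, \<open>W\<close> is constant on the negative integers. The
  constant is its limit at minus infinity, which is 0 because \<open>green\<close> vanishes
  there.\<close>

lemma W_neg: "W n = 0" if "n < 0"
proof -
  have const: "W (- 1 - int m) = W (- 1)" for m
  proof (induction m)
    case (Suc m)
    then show ?case using W_diff[of "- 1 - int m"] by (simp add: algebra_simps)
  qed simp
  have "(\<lambda>m. W (- int m)) \<longlonglongrightarrow> 0"
    using W_tendsto[of "\<lambda>m. - int m" 0] green_at_bot by simp
  then have "(\<lambda>m. W (- int (Suc m))) \<longlonglongrightarrow> 0" by (rule LIMSEQ_Suc)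
  moreover have "W (- int (Suc m)) = W (- 1)" for m using const[of m] by (simp add: algebra_simps)
  ultimately have "W (- 1) = 0" by (simp add: LIMSEQ_const_iff)
  then show ?thesis using const[of "nat (- 1 - n)"] that by simp
qed

lemma W_nonneg: "W (int m) = 1"
proof (induction m)
  case 0
  then show ?case using W_diff[of 0] W_neg[of "- 1"] by simp
next
  case (Suc m)
  then show ?case using W_diff[of "int (Suc m)"] by simp
qed

text \<open>The renewal theorem.  Every sequence of translates of \<open>green\<close> tending to infinity has a
  pointwise convergent subsequence, whose limit is harmonic, hence constant; \<open>W = 1\<close> determines
  the constant.\<close>

theorem green_tendsto: "(\<lambda>n. green (int n)) \<longlonglongrightarrow> 1 / (\<integral>k. of_int k \<partial>measure_pmf p)"
proof (rule ccontr)
  let ?c = "1 / (\<integral>k. of_int k \<partial>measure_pmf p)"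
  assume "\<not> (\<lambda>n. green (int n)) \<longlonglongrightarrow> ?c"
  then obtain e where e: "e > 0" and inf: "\<exists>\<^sub>F n in sequentially. dist (green (int n)) ?c \<ge> e"
    unfolding tendsto_iff by (auto simp: not_eventually not_less)
  define S where "S = {n. dist (green (int n)) ?c \<ge> e}"
  have "infinite S"
    using inf unfolding S_def frequently_cofinite[symmetric] cofinite_eq_sequentially .
  then have s: "strict_mono (enumerate S)" "\<And>n. enumerate S n \<in> S"
    by (auto simp: strict_mono_enumerate enumerate_in_set)
  obtain t where t: "strict_mono (t :: nat \<Rightarrow> nat)"
    and lim: "\<And>i. i \<in> UNIV \<Longrightarrow> \<exists>v. (\<lambda>n. green (int (enumerate S (t n)) + i)) \<longlonglongrightarrow> v"
    by (rule function_convergent_subsequence[of "UNIV :: int set" "\<lambda>n i. green (int (enumerate S n) + i)" "green 0"])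
      (auto simp: abs_green_le)
  define s' where "s' n = enumerate S (t n)" for n
  have s': "strict_mono s'" "\<And>n. s' n \<in> S"
    using strict_mono_o[OF s(1) t] s(2) unfolding s'_def[abs_def] o_def by auto
  have "\<forall>i. \<exists>x. (\<lambda>n. green (int (s' n) + i)) \<longlonglongrightarrow> x"
    using lim by (simp add: s'_def)
  then obtain v where v: "\<And>i. (\<lambda>n. green (int (s' n) + i)) \<longlonglongrightarrow> v i"
    by (auto dest!: choice)
  have bdd: "\<bar>v i\<bar> \<le> green 0" for i
    by (rule LIMSEQ_le_const2[OF tendsto_rabs[OF v]]) (auto simp: abs_green_le)
  have harm: "v i = (\<integral>k. v (i - k) \<partial>measure_pmf p)" for i
  proof (rule LIMSEQ_unique[OF v])
    \<comment> \<open>Since \<open>s'\<close> tends to infinity, the source term of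
      \<open>green_renewal\<close> is eventually 0 at \<open>s' n + i\<close>; this is why the limit
      \<open>v\<close> is harmonic everywhere.\<close>
    have "(\<lambda>n. of_bool (int (s' n) + i = 0) + (\<integral>k. green (int (s' n) + i - k) \<partial>measure_pmf p))
        \<longlonglongrightarrow> 0 + (\<integral>k. v (i - k) \<partial>measure_pmf p)"
    proof (intro tendsto_add integral_dominated_convergence[where w = "\<lambda>_. green 0"] AE_I2)
      have "\<forall>\<^sub>F n in sequentially. s' n \<ge> nat (- i) + 1"
        using filterlim_subseq[OF s'(1)] by (auto simp: filterlim_at_top)
      then have "\<forall>\<^sub>F n in sequentially. of_bool (int (s' n) + i = 0) = (0::real)"
        by eventually_elim auto
      then show "(\<lambda>n. of_bool (int (s' n) + i = 0)) \<longlonglongrightarrow> (0::real)"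
        by (rule tendsto_eventually)
      show "(\<lambda>n. green (int (s' n) + i - k)) \<longlonglongrightarrow> v (i - k)" for k
        using v[of "i - k"] by (simp add: algebra_simps)
    qed (auto simp: abs_green_le)
    then show "(\<lambda>n. green (int (s' n) + i)) \<longlonglongrightarrow> (\<integral>k. v (i - k) \<partial>measure_pmf p)"
      unfolding green_renewal[symmetric] add_0_left .
  qed
  have v_const: "v i = v 0" for i
    using bdd harm aperiodic by (rule harmonic_constant[of v "green 0" p])
  have "(\<lambda>n. green (int (s' n) + i)) \<longlonglongrightarrow> v 0" for i
    using v[of i] by (subst (asm) v_const)
  \<comment> \<open>\<open>W\<close> equals 1 along \<open>s'\<close>. The resulting equation also
    shows that the mean step is nonzero, so solving for \<open>v 0\<close> is legitimate.\<close>
  from W_tendsto[OF this] have "(\<integral>k. of_int k \<partial>measure_pmf p) * v 0 = 1"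
    by (simp add: W_nonneg LIMSEQ_const_iff)
  then have "v 0 = ?c" by (auto simp: eq_divide_eq mult.commute)
  then have "(\<lambda>n. green (int (s' n))) \<longlonglongrightarrow> ?c" using v[of 0] by simp
  then have "\<forall>\<^sub>F n in sequentially. dist (green (int (s' n))) ?c < e"
    using e by (rule tendstoD)
  then obtain n where "dist (green (int (s' n))) ?c < e"
    using eventually_happens'[OF sequentially_bot] by blast
  then show False using s'(2)[of n] by (simp add: S_def)
qed

end

section \<open>The renewal equation\<close>

text \<open>A Bochner integral, hence 0 by convention where the integrand is not integrable. For
  exponentially growing arguments integrability therefore has to be established before
  \<open>step\<close> can be treated as linear.\<close>

definition step :: "int pmf \<Rightarrow> (int \<Rightarrow> real) \<Rightarrow> int \<Rightarrow> real" where
  "step p f j = (\<integral>k. f (j - k) \<partial>measure_pmf p)"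

lemma integral_bind_pmf_bounded:
  fixes f :: "'b \<Rightarrow> real"
  assumes "\<And>x. \<bar>f x\<bar> \<le> B"
  shows "(\<integral>x. f x \<partial>bind_pmf p q) = (\<integral>y. (\<integral>x. f x \<partial>measure_pmf (q y)) \<partial>measure_pmf p)"
  unfolding measure_pmf_bind
  by (rule integral_bind[where K = "count_space UNIV" and B = B and B' = 1])
    (use assms measurable_space[OF measurable_measure_pmf, of _ q] in
      \<open>auto simp: measure_pmf.emeasure_space_1 space_measure_pmf\<close>)

lemma funpow_step_bounded:
  assumes "\<And>i. \<bar>f i\<bar> \<le> B"
  shows "(step p ^^ n) f j = (\<integral>s. f (j - s) \<partial>measure_pmf (walk p n))"
proof (induction n arbitrary: j)
  case (Suc n)
  have "(\<integral>s. f (j - s) \<partial>measure_pmf (walk p (Suc n))) =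
      (\<integral>k. (\<integral>s. f (j - (k + s)) \<partial>measure_pmf (walk p n)) \<partial>measure_pmf p)"
    using assms by (simp add: integral_bind_pmf_bounded[where B = B])
  also have "\<dots> = step p ((step p ^^ n) f) j"
    unfolding step_def[of p "(step p ^^ n) f"] Suc.IH by (simp add: algebra_simps)
  finally show ?case by simp
qed simp

lemma integral_measure_pmf_count_space:
  fixes f :: "'a \<Rightarrow> real"
  shows "(\<integral>x. f x \<partial>measure_pmf q) = (\<integral>x. pmf q x * f x \<partial>count_space UNIV)"
  unfolding measure_pmf_eq_density by (subst integral_density) auto

text \<open>Reflecting the variable moves the dependence on \<open>j\<close> from \<open>f\<close>
  to the kernel, so that kernels of different times can be added under one sum against
  \<open>f\<close>.\<close>

lemma integral_walk_shift:
  fixes f :: "int \<Rightarrow> real"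
  shows "(\<integral>s. f (j - s) \<partial>measure_pmf q) = (\<integral>i. pmf q (j - i) * f i \<partial>count_space UNIV)"
proof -
  have "pmf (map_pmf (\<lambda>s. j - s) q) i = pmf q (j - i)" for i
    using pmf_map_inj'[of "\<lambda>s. j - s" q "j - i"] by (simp add: inj_on_def)
  then show ?thesis
    using integral_measure_pmf_count_space[of "map_pmf (\<lambda>s. j - s) q" f] by simp
qed

lemma integrable_exp_bounded_shift:
  fixes p :: "int pmf" and f :: "int \<Rightarrow> real"
  assumes "integrable (measure_pmf p) (\<lambda>k. exp (- a * of_int k))"
    and "\<And>j. \<bar>f j\<bar> \<le> C * exp (a * of_int j)"
  shows "integrable (measure_pmf p) (\<lambda>k. f (j - k))"
proof (rule Bochner_Integration.integrable_bound)
  show "integrable (measure_pmf p) (\<lambda>k. C * exp (a * of_int j) * exp (- a * of_int k))"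
    using assms(1) by (rule integrable_mult_right)
  have "\<bar>f (j - k)\<bar> \<le> \<bar>C * exp (a * of_int j) * exp (- a * of_int k)\<bar>" for k
    using order_trans[OF assms(2)[of "j - k"] abs_ge_self]
    by (simp add: mult.assoc exp_add[symmetric] algebra_simps)
  then show "AE k in measure_pmf p. norm (f (j - k)) \<le> norm (C * exp (a * of_int j) * exp (- a * of_int k))"
    by simp
qed simp

section \<open>Iterating the renewal operator on exponentially growing functions\<close>

context transient_walk
begin

text \<open>The two weights behave differently: averaging multiplies \<open>exp (2 * l * j)\<close>
  by at most 1 but contracts \<open>exp (l * j)\<close> by the factor \<open>\<rho>\<close>.\<close>

lemma abs_step_le:
  assumes int2: "integrable (measure_pmf p) (\<lambda>k. exp (- 2 * l * of_int k))"
    and le_1: "(\<integral>k. exp (- 2 * l * of_int k) \<partial>measure_pmf p) \<le> 1"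
    and bound: "\<And>j. \<bar>f j\<bar> \<le> a * exp (2 * l * of_int j) + b * exp (l * of_int j)"
    and nonneg: "a \<ge> 0" "b \<ge> 0"
  shows "\<bar>step p f j\<bar> \<le> a * exp (2 * l * of_int j) + b * \<rho> * exp (l * of_int j)"
proof -
  let ?g = "\<lambda>k. a * exp (2 * l * of_int j) * exp (- 2 * l * of_int k) +
      b * exp (l * of_int j) * exp (- l * of_int k)"
  have int_g: "integrable (measure_pmf p) ?g"
    by (intro Bochner_Integration.integrable_add integrable_mult_right int2 integrable_exp)
  have le_g: "\<bar>f (j - k)\<bar> \<le> ?g k" for k
    using bound[of "j - k"] by (simp add: mult.assoc exp_add[symmetric] algebra_simps)
  have int_f: "integrable (measure_pmf p) (\<lambda>k. f (j - k))"
    by (rule Bochner_Integration.integrable_bound[OF int_g])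
      (use le_g order_trans[OF le_g abs_ge_self] in auto)
  have "\<bar>step p f j\<bar> \<le> (\<integral>k. \<bar>f (j - k)\<bar> \<partial>measure_pmf p)"
    unfolding step_def by (rule integral_abs_bound)
  also have "\<dots> \<le> (\<integral>k. ?g k \<partial>measure_pmf p)"
    using int_f int_g le_g by (intro integral_mono) auto
  also have "\<dots> = a * exp (2 * l * of_int j) * (\<integral>k. exp (- 2 * l * of_int k) \<partial>measure_pmf p)
      + b * exp (l * of_int j) * \<rho>"
    using integrable_mult_right[OF int2, of "a * exp (2 * l * of_int j)"]
      integrable_mult_right[OF integrable_exp, of "b * exp (l * of_int j)"]
    by (simp only: Bochner_Integration.integral_add integral_mult_right_zero expectation_exp)
  also have "\<dots> \<le> a * exp (2 * l * of_int j) * 1 + b * exp (l * of_int j) * \<rho>"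
    using le_1 nonneg by (intro add_mono mult_left_mono) auto
  finally show ?thesis by (simp add: mult_ac)
qed

lemma abs_funpow_step_le:
  assumes "integrable (measure_pmf p) (\<lambda>k. exp (- 2 * l * of_int k))"
    and "(\<integral>k. exp (- 2 * l * of_int k) \<partial>measure_pmf p) \<le> 1"
    and "\<And>j. \<bar>f j\<bar> \<le> a * exp (2 * l * of_int j) + b * exp (l * of_int j)"
    and "a \<ge> 0" "b \<ge> 0"
  shows "\<bar>(step p ^^ n) f j\<bar> \<le> a * exp (2 * l * of_int j) + b * \<rho> ^ n * exp (l * of_int j)"
proof (induction n arbitrary: j)
  case (Suc n)
  have "\<bar>step p ((step p ^^ n) f) j\<bar> \<le> a * exp (2 * l * of_int j) + (b * \<rho> ^ n) * \<rho> * exp (l * of_int j)"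
    by (rule abs_step_le) (use Suc.IH assms rho_nonneg in auto)
  then show ?case by (simp add: mult_ac)
qed (use assms in auto)

text \<open>As \<open>r\<close> is of smaller order than \<open>exp (2 * l * j)\<close> at infinity,
  it is bounded by \<open>a * exp (2 * l * j) + b * exp (l * j)\<close> with \<open>a\<close> as
  small as desired. Under iteration the first term does not grow and the second decays
  geometrically.\<close>

lemma funpow_step_tendsto_0:
  fixes r :: "int \<Rightarrow> real"
  assumes int2: "integrable (measure_pmf p) (\<lambda>k. exp (- 2 * l * of_int k))"
    and le_1: "(\<integral>k. exp (- 2 * l * of_int k) \<partial>measure_pmf p) \<le> 1"
    and bound: "\<And>j. \<bar>r j\<bar> \<le> C * exp (2 * l * of_int j)"
    and decay: "(\<lambda>n. r (int n) * exp (- 2 * l * real n)) \<longlonglongrightarrow> 0"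
  shows "(\<lambda>n. (step p ^^ n) r j) \<longlonglongrightarrow> 0"
proof (rule LIMSEQ_I)
  fix e :: real assume e: "e > 0"
  have C: "C \<ge> 0" using order_trans[OF abs_ge_zero bound[of 0]] by simp
  define a where "a = e / (2 * exp (2 * l * of_int j))"
  have a: "a > 0" "a * exp (2 * l * of_int j) = e / 2" using e by (simp_all add: a_def)
  from LIMSEQ_D[OF decay a(1)] obtain N :: nat
    where N: "\<And>n. n \<ge> N \<Longrightarrow> \<bar>r (int n) * exp (- 2 * l * real n)\<bar> < a" by auto
  \<comment> \<open>To the left of \<open>N\<close>, one of the two factors
    \<open>exp (l * i)\<close> in the a priori bound is at most \<open>exp (l * N)\<close>; the
    other stays as the weight that is contracted.\<close>
  define b where "b = C * exp (l * of_int (int N))"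
  have b: "b \<ge> 0" using C by (simp add: b_def)
  have bound': "\<bar>r i\<bar> \<le> a * exp (2 * l * of_int i) + b * exp (l * of_int i)" for i
  proof (cases "i \<ge> int N")
    case True
    have "\<bar>r i\<bar> * exp (- 2 * l * of_int i) < a"
      using N[of "nat i"] True by (simp add: abs_mult)
    then have "\<bar>r i\<bar> * exp (- 2 * l * of_int i) * exp (2 * l * of_int i) \<le> a * exp (2 * l * of_int i)"
      by (intro mult_right_mono) auto
    also have "\<bar>r i\<bar> * exp (- 2 * l * of_int i) * exp (2 * l * of_int i) = \<bar>r i\<bar>"
      by (simp add: mult.assoc exp_add[symmetric])
    finally show ?thesis using b by (simp add: add_increasing2)
  next
    case False
    have "exp (2 * l * of_int i) = exp (l * of_int i) * exp (l * of_int i)"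
      by (simp add: exp_add[symmetric])
    also have "\<dots> \<le> exp (l * of_int (int N)) * exp (l * of_int i)"
      using False l_pos by (intro mult_right_mono) auto
    finally have "C * exp (2 * l * of_int i) \<le> b * exp (l * of_int i)"
      using C unfolding b_def mult.assoc by (rule mult_left_mono)
    moreover have "a * exp (2 * l * of_int i) \<ge> 0" using a(1) by simp
    ultimately show ?thesis using bound[of i] by linarith
  qed
  have "(\<lambda>n. b * \<rho> ^ n * exp (l * of_int j)) \<longlonglongrightarrow> b * 0 * exp (l * of_int j)"
    using rho_nonneg rho_less_1 by (intro tendsto_intros LIMSEQ_power_zero) simp
  then have lim: "(\<lambda>n. b * \<rho> ^ n * exp (l * of_int j)) \<longlonglongrightarrow> 0" by simp
  have "e / 2 > 0" using e by simp
  from LIMSEQ_D[OF lim this] obtain n0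
    where n0: "\<And>n. n \<ge> n0 \<Longrightarrow> b * \<rho> ^ n * exp (l * of_int j) < e / 2"
    by (force simp: abs_less_iff)
  show "\<exists>n0. \<forall>n\<ge>n0. norm ((step p ^^ n) r j - 0) < e"
  proof (intro exI allI impI)
    fix n assume "n \<ge> n0"
    then show "norm ((step p ^^ n) r j - 0) < e"
      using abs_funpow_step_le[OF int2 le_1 bound', of n j] n0[of n] a b by simp
  qed
qed

text \<open>Substituting the equation into itself requires exchanging \<open>step\<close> with a
  finite sum. The bounds with \<open>b = 0\<close> keep all iterates below a multiple of
  \<open>exp (2 * l * j)\<close>, which makes every term integrable.\<close>

lemma renewal_equation_unfold:
  fixes r f :: "int \<Rightarrow> real"
  assumes int2: "integrable (measure_pmf p) (\<lambda>k. exp (- 2 * l * of_int k))"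
    and le_1: "(\<integral>k. exp (- 2 * l * of_int k) \<partial>measure_pmf p) \<le> 1"
    and bound: "\<And>j. \<bar>r j\<bar> \<le> C * exp (2 * l * of_int j)"
    and eq: "\<And>j. r j = f j + step p r j"
  shows "r j = (\<Sum>m<n. (step p ^^ m) f j) + (step p ^^ n) r j"
proof (induction n arbitrary: j)
  case (Suc n)
  have C: "C \<ge> 0" using order_trans[OF abs_ge_zero bound[of 0]] by simp
  have pow_le: "\<bar>(step p ^^ m) g i\<bar> \<le> D * exp (2 * l * of_int i)"
    if "\<And>j. \<bar>g j\<bar> \<le> D * exp (2 * l * of_int j)" "D \<ge> 0" for g D m i
    using abs_funpow_step_le[OF int2 le_1, of g D 0 m i] that by simp
  \<comment> \<open>\<open>f\<close> is the difference of \<open>r\<close> and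
    \<open>step p r\<close>, each bounded with the constant \<open>C\<close>.\<close>
  have f_le: "\<bar>f i\<bar> \<le> 2 * C * exp (2 * l * of_int i)" for i
    using bound[of i] pow_le[OF bound C, of 1 i] eq[of i] by simp
  have int_pow: "integrable (measure_pmf p) (\<lambda>k. (step p ^^ m) g (i - k))"
    if "\<And>j. \<bar>g j\<bar> \<le> D * exp (2 * l * of_int j)" "D \<ge> 0" for g D m i
    by (rule integrable_exp_bounded_shift[where a = "2 * l" and C = D])
      (use int2 pow_le[OF that] in simp_all)
  have "step p r j = (\<integral>k. (\<Sum>m<n. (step p ^^ m) f (j - k)) + (step p ^^ n) r (j - k) \<partial>measure_pmf p)"
    unfolding step_def[of p r] by (subst Suc.IH) simp
  also have "\<dots> = (\<Sum>m<n. step p ((step p ^^ m) f) j) + step p ((step p ^^ n) r) j"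
    unfolding step_def[of p "(step p ^^ _) _"]
    using int_pow[OF f_le] int_pow[OF bound C] C
    by (simp add: Bochner_Integration.integral_add Bochner_Integration.integral_sum)
  finally show ?case
    using eq[of j] by (subst sum.lessThan_Suc_shift) simp
qed simp

end

context renewal_walk
begin

text \<open>The representation of \<open>r\<close> as a convolution with \<open>green\<close> also
  identifies the limit: the sum of \<open>f\<close> divided by the mean step.\<close>

theorem renewal_equation_convergent:
  fixes r f :: "int \<Rightarrow> real"
  assumes int2: "integrable (measure_pmf p) (\<lambda>k. exp (- 2 * l * of_int k))"
    and le_1: "(\<integral>k. exp (- 2 * l * of_int k) \<partial>measure_pmf p) \<le> 1"
    and bound: "\<And>j. \<bar>r j\<bar> \<le> C * exp (2 * l * of_int j)"
    and decay: "(\<lambda>n. r (int n) * exp (- 2 * l * real n)) \<longlonglongrightarrow> 0"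
    and eq: "\<And>j. r j = f j + step p r j"
    and int_f: "integrable (count_space UNIV) f"
  shows "convergent (\<lambda>n. r (int n))"
proof -
  define B where "B = (\<integral>i. \<bar>f i\<bar> \<partial>count_space UNIV)"
  \<comment> \<open>A summable function is bounded by its l1 norm; boundedness lets the iterates of
    \<open>step\<close> on \<open>f\<close> be written through the walk laws.\<close>
  have f_le: "\<bar>f i\<bar> \<le> B" for i
  proof -
    have "\<bar>f i\<bar> = (\<integral>j. \<bar>f i\<bar> * indicator {i} j \<partial>count_space UNIV)" by simp
    also have "\<dots> \<le> B"
      unfolding B_def
    proof (rule integral_mono)
      show "integrable (count_space UNIV) (\<lambda>j. \<bar>f i\<bar> * indicator {i} j)"
        by (rule Bochner_Integration.integrable_bound[OF int_f]) (auto simp: indicator_def)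
    qed (use int_f in \<open>auto simp: indicator_def\<close>)
    finally show ?thesis .
  qed
  have r_eq: "r j = (\<integral>i. green (j - i) * f i \<partial>count_space UNIV)" for j
  proof (rule LIMSEQ_unique)
    have "(\<lambda>n. r j - (step p ^^ n) r j) \<longlonglongrightarrow> r j - 0"
      by (intro tendsto_intros funpow_step_tendsto_0[OF int2 le_1 bound decay])
    moreover have "r j - (step p ^^ n) r j = (\<Sum>m<n. (step p ^^ m) f j)" for n
      using renewal_equation_unfold[OF int2 le_1 bound eq, of j n] by simp
    ultimately show "(\<lambda>n. \<Sum>m<n. (step p ^^ m) f j) \<longlonglongrightarrow> r j" by simp
    have "(\<Sum>m<n. (step p ^^ m) f j) =
        (\<integral>i. (\<Sum>m<n. pmf (walk p m) (j - i)) * f i \<partial>count_space UNIV)" for n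
    proof -
      have "(\<Sum>m<n. (step p ^^ m) f j) = (\<Sum>m<n. \<integral>i. pmf (walk p m) (j - i) * f i \<partial>count_space UNIV)"
        by (simp add: funpow_step_bounded[OF f_le] integral_walk_shift)
      also have "\<dots> = (\<integral>i. (\<Sum>m<n. pmf (walk p m) (j - i) * f i) \<partial>count_space UNIV)"
      proof (rule Bochner_Integration.integral_sum[symmetric])
        show "integrable (count_space UNIV) (\<lambda>i. pmf (walk p m) (j - i) * f i)" for m
          by (rule Bochner_Integration.integrable_bound[OF int_f])
            (auto simp: abs_mult pmf_le_1 intro!: mult_left_le_one_le)
      qed
      finally show ?thesis by (simp add: sum_distrib_right)
    qed
    then show "(\<lambda>n. \<Sum>m<n. (step p ^^ m) f j) \<longlonglongrightarrow> (\<integral>i. green (j - i) * f i \<partial>count_space UNIV)"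
    proof (simp only:, intro integral_dominated_convergence[where w = "\<lambda>i. green 0 * \<bar>f i\<bar>"] AE_I2)
      show "(\<lambda>n. (\<Sum>m<n. pmf (walk p m) (j - i)) * f i) \<longlonglongrightarrow> green (j - i) * f i" for i
        by (intro tendsto_mult partial_green_tendsto tendsto_const)
      show "norm ((\<Sum>m<n. pmf (walk p m) (j - i)) * f i) \<le> green 0 * \<bar>f i\<bar>" for n i
        using order_trans[OF partial_green_le[of "j - i" n] green_le_0[of "j - i"]]
        by (auto simp: abs_mult sum_nonneg intro!: mult_right_mono)
    qed (auto simp: integrable_abs[OF int_f])
  qed
  let ?c = "1 / (\<integral>k. of_int k \<partial>measure_pmf p)"
  have green_shift: "(\<lambda>n. green (int n - i)) \<longlonglongrightarrow> ?c" for i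
  proof -
    \<comment> \<open>\<open>green_tendsto\<close> runs over natural numbers, so the shifted index
      is truncated by \<open>nat\<close>; the truncation is inactive from \<open>n = i\<close>
      on.\<close>
    have "filterlim (\<lambda>n. nat (int n - i)) at_top sequentially"
      unfolding filterlim_at_top
    proof
      fix Z
      show "\<forall>\<^sub>F n in sequentially. Z \<le> nat (int n - i)"
        using eventually_ge_at_top[of "nat (int Z + i)"] by eventually_elim auto
    qed
    from filterlim_compose[OF green_tendsto this]
    have "(\<lambda>n. green (int (nat (int n - i)))) \<longlonglongrightarrow> ?c" .
    moreover have "\<forall>\<^sub>F n in sequentially. green (int (nat (int n - i))) = green (int n - i)"
      using eventually_ge_at_top[of "nat i"] by eventually_elim auto
    ultimately show ?thesis by (rule Lim_transform_eventually)
  qed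
  have "(\<lambda>n. r (int n)) \<longlonglongrightarrow> (\<integral>i. ?c * f i \<partial>count_space UNIV)"
    unfolding r_eq
  proof (intro integral_dominated_convergence[where w = "\<lambda>i. green 0 * \<bar>f i\<bar>"] AE_I2)
    show "(\<lambda>n. green (int n - i) * f i) \<longlonglongrightarrow> ?c * f i" for i
      by (intro tendsto_mult green_shift tendsto_const)
    show "norm (green (int n - i) * f i) \<le> green 0 * \<bar>f i\<bar>" for n i
      using abs_green_le[of "int n - i"] by (auto simp: abs_mult intro!: mult_right_mono)
  qed (auto simp: integrable_abs[OF int_f])
  then show ?thesis by (rule convergentI)
qed

end

section \<open>The tilted law\<close>

lemma (in prob_space) prob_eq_integral_if:
  "prob {\<omega> \<in> space M. P \<omega>} = (\<integral>\<omega>. (if P \<omega> then 1 else 0) \<partial>M)"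
proof -
  have "{\<omega> \<in> space M. P \<omega>} \<inter> space M = {\<omega> \<in> space M. P \<omega>}" by auto
  then have "prob {\<omega> \<in> space M. P \<omega>} = (\<integral>\<omega>. indicator {\<omega> \<in> space M. P \<omega>} \<omega> \<partial>M)" by simp
  also have "\<dots> = (\<integral>\<omega>. (if P \<omega> then 1 else 0) \<partial>M)"
    by (intro Bochner_Integration.integral_cong) (auto simp: indicator_def)
  finally show ?thesis .
qed

lemma (in prob_space) measurable_prob_mult_gt:
  fixes A X :: "'a \<Rightarrow> real"
  assumes [measurable]: "A \<in> borel_measurable M" "X \<in> borel_measurable M"
  shows "(\<lambda>\<omega>. prob {\<omega>' \<in> space M. A \<omega> * X \<omega>' > t}) \<in> borel_measurable M"
  unfolding prob_eq_integral_if by measurable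

text \<open>Conditioning on \<open>A\<close>: by independence the joint law is a product measure,
  and Fubini slices the region \<open>fst z * snd z > t\<close> at
  \<open>A \<omega>\<close>.\<close>

lemma (in prob_space) prob_mult_gt_indep:
  fixes A X :: "'a \<Rightarrow> real"
  assumes indep: "indep_var borel A borel X"
  shows "prob {\<omega> \<in> space M. A \<omega> * X \<omega> > t} =
    (\<integral>\<omega>. prob {\<omega>' \<in> space M. A \<omega> * X \<omega>' > t} \<partial>M)"
proof -
  have [measurable]: "A \<in> borel_measurable M" "X \<in> borel_measurable M"
    and eq: "distr M borel A \<Otimes>\<^sub>M distr M borel X = distr M (borel \<Otimes>\<^sub>M borel) (\<lambda>\<omega>. (A \<omega>, X \<omega>))"
    using indep by (auto simp: indep_var_distribution_eq)
  interpret PX: prob_space "distr M borel X" by (rule prob_space_distr) simp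
  define S where "S = {z :: real \<times> real. fst z * snd z > t}"
  have "{z \<in> space (borel \<Otimes>\<^sub>M borel). fst z * snd z > t} \<in> sets (borel \<Otimes>\<^sub>M borel)"
    by measurable
  moreover have "{z \<in> space (borel \<Otimes>\<^sub>M borel). fst z * snd z > t} = S"
    by (auto simp: S_def space_pair_measure)
  ultimately have S[measurable]: "S \<in> sets (borel \<Otimes>\<^sub>M borel)" by simp
  have "emeasure M {\<omega> \<in> space M. A \<omega> * X \<omega> > t} =
      emeasure (distr M (borel \<Otimes>\<^sub>M borel) (\<lambda>\<omega>. (A \<omega>, X \<omega>))) S"
    by (subst emeasure_distr[OF _ S]) (auto simp: S_def intro!: arg_cong[where f = "emeasure M"])
  also have "\<dots> = (\<integral>\<^sup>+a. emeasure (distr M borel X) (Pair a -` S) \<partial>distr M borel A)"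
    unfolding eq[symmetric] by (rule PX.emeasure_pair_measure_alt) (use S in simp)
  also have "\<dots> = (\<integral>\<^sup>+\<omega>. emeasure (distr M borel X) (Pair (A \<omega>) -` S) \<partial>M)"
    by (rule nn_integral_distr) (use PX.measurable_emeasure_Pair[of S borel] in simp_all)
  also have "\<dots> = (\<integral>\<^sup>+\<omega>. ennreal (prob {\<omega>' \<in> space M. A \<omega> * X \<omega>' > t}) \<partial>M)"
  proof (rule nn_integral_cong)
    fix \<omega>
    have "emeasure (distr M borel X) (Pair (A \<omega>) -` S) = emeasure M {\<omega>' \<in> space M. A \<omega> * X \<omega>' > t}"
      by (subst emeasure_distr[OF _ sets_Pair1[OF S]])
        (auto simp: S_def intro!: arg_cong[where f = "emeasure M"])
    then show "emeasure (distr M borel X) (Pair (A \<omega>) -` S) = ennreal (prob {\<omega>' \<in> space M. A \<omega> * X \<omega>' > t})"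
      by (simp add: emeasure_eq_measure)
  qed
  also have "\<dots> = ennreal (\<integral>\<omega>. prob {\<omega>' \<in> space M. A \<omega> * X \<omega>' > t} \<partial>M)"
    by (intro nn_integral_eq_integral integrable_const_bound[where B = 1] measurable_prob_mult_gt) auto
  finally show ?thesis
    by (simp add: emeasure_eq_measure Bochner_Integration.integral_nonneg)
qed

lemma (in prob_space) tail_tendsto_0:
  fixes X :: "'a \<Rightarrow> real" and s :: "nat \<Rightarrow> real"
  assumes [measurable]: "X \<in> borel_measurable M" and s: "filterlim s at_top sequentially"
  shows "(\<lambda>n. prob {\<omega> \<in> space M. X \<omega> > s n}) \<longlonglongrightarrow> 0"
proof -
  have "(\<lambda>n. \<integral>\<omega>. (if X \<omega> > s n then 1 else 0) \<partial>M) \<longlonglongrightarrow> (\<integral>\<omega>. (0::real) \<partial>M)"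
  proof (rule integral_dominated_convergence[where w = "\<lambda>_. 1"], goal_cases)
    case 4
    have "(\<lambda>n. if X \<omega> > s n then 1 else 0) \<longlonglongrightarrow> (0::real)" for \<omega>
    proof (rule tendsto_eventually)
      have "\<forall>\<^sub>F n in sequentially. X \<omega> \<le> s n" using s unfolding filterlim_at_top by blast
      then show "\<forall>\<^sub>F n in sequentially. (if X \<omega> > s n then 1 else 0) = (0::real)"
        by eventually_elim auto
    qed
    then show ?case by simp
  qed auto
  then show ?thesis unfolding prob_eq_integral_if by simp
qed

section \<open>The change of measure with density \<open>A powr \<kappa>\<close>\<close>

locale arithmetic_tilt = prob_space M for M :: "'a measure" +
  fixes A :: "'a \<Rightarrow> real" and \<kappa> h :: real
  assumes kappa_pos: "\<kappa> > 0" and h_pos: "h > 0"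
    and A_measurable [measurable]: "A \<in> borel_measurable M"
    and A_nonneg: "AE \<omega> in M. A \<omega> \<ge> 0"
    and integrable_powr: "integrable M (\<lambda>\<omega>. A \<omega> powr \<kappa>)"
    and expectation_powr: "(\<integral>\<omega>. A \<omega> powr \<kappa> \<partial>M) = 1"
    and integrable_log_plus: "integrable M (\<lambda>\<omega>. A \<omega> powr \<kappa> * log_plus (A \<omega>))"
    and span: "has_arithmetic_span (cond_log_distr M A) h"
begin

text \<open>The floor makes \<open>Z\<close> a total measurable integer variable. It is exact almost
  surely where \<open>A\<close> is nonzero (\<open>AE_lattice\<close>), and elsewhere the tilting
  weight vanishes.\<close>

definition Z :: "'a \<Rightarrow> int" where "Z \<omega> = \<lfloor>ln (A \<omega>) / h\<rfloor>"

lemma Z_measurable [measurable]: "Z \<in> measurable M (count_space UNIV)"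
  unfolding Z_def by measurable

text \<open>The Esscher transform of the law of \<open>Z\<close>; \<open>measure_tilted_law\<close>
  checks that its mass is 1, which is the moment condition on \<open>A\<close>.\<close>

definition tilted_law :: "int pmf" where
  "tilted_law = Abs_pmf (distr (density M (\<lambda>\<omega>. ennreal (A \<omega> powr \<kappa>))) (count_space UNIV) Z)"

lemma measure_tilted_law:
  "measure_pmf tilted_law = distr (density M (\<lambda>\<omega>. ennreal (A \<omega> powr \<kappa>))) (count_space UNIV) Z"
  unfolding tilted_law_def
proof (rule Abs_pmf_inverse, intro CollectI conjI)
  let ?N = "density M (\<lambda>\<omega>. ennreal (A \<omega> powr \<kappa>))"
  have "(\<integral>\<^sup>+\<omega>. ennreal (A \<omega> powr \<kappa>) \<partial>M) = 1"
    using nn_integral_eq_integral[OF integrable_powr] expectation_powr by simp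
  then have "prob_space ?N"
    by (intro prob_spaceI) (simp add: emeasure_density cong: nn_integral_cong)
  then interpret N: prob_space ?N .
  show P: "prob_space (distr ?N (count_space UNIV) Z)" by (rule N.prob_space_distr) simp
  then interpret D: prob_space "distr ?N (count_space UNIV) Z" .
  show "AE k in distr ?N (count_space UNIV) Z. measure (distr ?N (count_space UNIV) Z) {k} \<noteq> 0"
    by (subst D.AE_support_countable) (auto intro!: exI[of _ UNIV])
qed simp

lemma integrable_tilted_law:
  fixes f :: "int \<Rightarrow> real"
  shows "integrable (measure_pmf tilted_law) f \<longleftrightarrow> integrable M (\<lambda>\<omega>. A \<omega> powr \<kappa> * f (Z \<omega>))"
  unfolding measure_tilted_law
  by (subst integrable_distr_eq) (auto simp: integrable_density)

lemma integral_tilted_law: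
  fixes f :: "int \<Rightarrow> real"
  shows "(\<integral>k. f k \<partial>measure_pmf tilted_law) = (\<integral>\<omega>. A \<omega> powr \<kappa> * f (Z \<omega>) \<partial>M)"
  unfolding measure_tilted_law
  by (subst integral_distr) (auto simp: integral_density)

lemma AE_tilted_law:
  "(AE k in measure_pmf tilted_law. P k) \<longleftrightarrow> (AE \<omega> in M. A \<omega> \<noteq> 0 \<longrightarrow> P (Z \<omega>))"
  unfolding measure_tilted_law
  by (subst AE_distr_iff) (auto simp: AE_density)

lemma AE_cond_log_distr:
  assumes "S \<in> sets borel"
  shows "(AE y in cond_log_distr M A. y \<in> S) \<longleftrightarrow> (AE \<omega> in M. A \<omega> \<noteq> 0 \<longrightarrow> ln (A \<omega>) \<in> S)"
proof -
  have "emeasure M {\<omega> \<in> space M. A \<omega> \<noteq> 0} \<noteq> 0"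
  proof
    assume "emeasure M {\<omega> \<in> space M. A \<omega> \<noteq> 0} = 0"
    then have "AE \<omega> in M. A \<omega> = 0" by (subst AE_iff_measurable[OF _ refl]) auto
    then have "(\<integral>\<omega>. A \<omega> powr \<kappa> \<partial>M) = (\<integral>\<omega>. 0 \<partial>M)" by (intro integral_cong_AE) auto
    then show False using expectation_powr by simp
  qed
  then have "(AE \<omega> in uniform_measure M {\<omega> \<in> space M. A \<omega> \<noteq> 0}. ln (A \<omega>) \<in> S) \<longleftrightarrow>
      (AE \<omega> in M. \<omega> \<in> {\<omega> \<in> space M. A \<omega> \<noteq> 0} \<longrightarrow> ln (A \<omega>) \<in> S)"
    by (intro AE_uniform_measure) (auto simp: emeasure_eq_measure)
  also have "\<dots> \<longleftrightarrow> (AE \<omega> in M. A \<omega> \<noteq> 0 \<longrightarrow> ln (A \<omega>) \<in> S)"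
    by (rule AE_cong) auto
  finally show ?thesis
    unfolding cond_log_distr_def using assms
    by (subst AE_distr_iff) (auto simp: uniform_measure_def)
qed

lemma lattice_points_borel: "lattice_points d \<in> sets borel"
  unfolding lattice_points_def by (rule sets.countable) auto

lemma AE_lattice: "AE \<omega> in M. A \<omega> \<noteq> 0 \<longrightarrow> A \<omega> = exp (h * of_int (Z \<omega>))"
proof -
  have "AE y in cond_log_distr M A. y \<in> lattice_points h"
    using span by (simp add: has_arithmetic_span_def arithmetic_steps_def)
  then have "AE \<omega> in M. A \<omega> \<noteq> 0 \<longrightarrow> ln (A \<omega>) \<in> lattice_points h"
    by (simp add: AE_cond_log_distr lattice_points_borel)
  then show ?thesis using A_nonneg
  proof eventually_elim
    case (elim \<omega>)
    show ?case
    proof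
      assume "A \<omega> \<noteq> 0"
      with elim obtain k :: int where "A \<omega> > 0" and k: "ln (A \<omega>) = h * of_int k"
        by (auto simp: lattice_points_def)
      moreover from k have "Z \<omega> = k" using h_pos by (simp add: Z_def)
      ultimately show "A \<omega> = exp (h * of_int (Z \<omega>))" by (metis exp_ln)
    qed
  qed
qed

lemma step_le_span:
  assumes d: "d > 0" and "AE \<omega> in M. A \<omega> \<noteq> 0 \<longrightarrow> ln (A \<omega>) \<in> lattice_points d"
  shows "d \<le> h"
proof -
  have "d \<in> arithmetic_steps (cond_log_distr M A)"
    using assms by (simp add: arithmetic_steps_def AE_cond_log_distr lattice_points_borel)
  then show ?thesis using span by (simp add: has_arithmetic_span_def)
qed

lemma Gcd_tilted_law: "Gcd (set_pmf tilted_law) = 1"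
proof -
  define d where "d = Gcd (set_pmf tilted_law)"
  have dvd: "AE \<omega> in M. A \<omega> \<noteq> 0 \<longrightarrow> d dvd Z \<omega>"
    unfolding AE_tilted_law[symmetric] d_def by (auto simp: AE_measure_pmf_iff)
  \<comment> \<open>If \<open>d = 0\<close> then \<open>Z\<close> vanishes almost surely where
    \<open>A\<close> is nonzero, and any lattice contains \<open>ln A\<close>; the value 2 then
    contradicts the maximality of \<open>h\<close> just as a gcd above 1 would.\<close>
  define e where "e = (if d = 0 then 2 else d)"
  have d_nonneg: "d \<ge> 0" by (simp add: d_def)
  then have e: "e > 0" by (simp add: e_def)
  have "AE \<omega> in M. A \<omega> \<noteq> 0 \<longrightarrow> ln (A \<omega>) \<in> lattice_points (h * of_int e)"
    using dvd AE_lattice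
  proof eventually_elim
    case (elim \<omega>)
    show ?case
    proof
      assume nz: "A \<omega> \<noteq> 0"
      have "e dvd Z \<omega>" using elim nz by (auto simp: e_def)
      then obtain k where "Z \<omega> = e * k" by (rule dvdE)
      then have "ln (A \<omega>) = h * of_int e * of_int k" using elim nz by simp
      then show "ln (A \<omega>) \<in> lattice_points (h * of_int e)" by (auto simp: lattice_points_def)
    qed
  qed
  then have "h * of_int e \<le> h" using e h_pos by (intro step_le_span) auto
  then have "e = 1" using e h_pos by simp
  then show ?thesis by (simp add: d_def[symmetric] e_def split: if_splits)
qed

text \<open>Pointwise form of the moment dictionary: an exponential moment of \<open>Z\<close> of
  order \<open>- a * h\<close> under the tilted law is the moment of \<open>A\<close> of order
  \<open>\<kappa> - a\<close>. It is applied with \<open>a = \<kappa> / 2\<close> and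
  \<open>a = \<kappa>\<close>.\<close>

lemma powr_times_exp:
  assumes "A \<omega> \<noteq> 0 \<longrightarrow> A \<omega> = exp (h * of_int (Z \<omega>))"
  shows "A \<omega> powr \<kappa> * exp (- a * (h * of_int (Z \<omega>))) = A \<omega> powr (\<kappa> - a)"
proof (cases "A \<omega> = 0")
  case False
  define z where "z = h * of_int (Z \<omega>)"
  have "A \<omega> = exp z" using False assms by (simp add: z_def)
  then show ?thesis
    unfolding z_def[symmetric] by (simp add: powr_def exp_add[symmetric] algebra_simps)
qed simp

lemma integrable_powr_half: "integrable M (\<lambda>\<omega>. A \<omega> powr (\<kappa> / 2))"
proof (rule Bochner_Integration.integrable_bound)
  show "integrable M (\<lambda>\<omega>. 1 + A \<omega> powr \<kappa>)" using integrable_powr by simp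
  have "A \<omega> powr (\<kappa> / 2) \<le> 1 + A \<omega> powr \<kappa>" for \<omega>
  proof -
    have "A \<omega> powr \<kappa> = (A \<omega> powr (\<kappa> / 2))\<^sup>2" by (simp add: power2_eq_square powr_add[symmetric])
    moreover have "2 * A \<omega> powr (\<kappa> / 2) \<le> 1 + (A \<omega> powr (\<kappa> / 2))\<^sup>2"
      using sum_squares_bound[of 1 "A \<omega> powr (\<kappa> / 2)"] by simp
    moreover have "A \<omega> powr (\<kappa> / 2) \<ge> 0" by simp
    ultimately show ?thesis by linarith
  qed
  then show "AE \<omega> in M. norm (A \<omega> powr (\<kappa> / 2)) \<le> norm (1 + A \<omega> powr \<kappa>)"
    by (auto intro!: AE_I2 order_trans[OF _ abs_ge_self])
qed simp

text \<open>The mean of \<open>(A powr (\<kappa> / 2) - 1)\<^sup>2\<close> is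
  \<open>2 - 2 * E\<close> with \<open>E\<close> the moment in question, so \<open>E\<close> is at
  most 1. Equality would force \<open>ln A = 0\<close> almost surely, and then \<open>2 * h\<close>
  would be an arithmetic step as well.\<close>

lemma expectation_powr_half: "(\<integral>\<omega>. A \<omega> powr (\<kappa> / 2) \<partial>M) < 1"
proof -
  define g where "g \<omega> = (A \<omega> powr (\<kappa> / 2) - 1)\<^sup>2" for \<omega>
  have g_eq: "g \<omega> = A \<omega> powr \<kappa> - 2 * A \<omega> powr (\<kappa> / 2) + 1" for \<omega>
    by (simp add: g_def power2_eq_square algebra_simps powr_add[symmetric])
  have int_g: "integrable M g"
    unfolding g_eq using integrable_powr integrable_powr_half by simp
  have "(\<integral>\<omega>. g \<omega> \<partial>M) = 2 - 2 * (\<integral>\<omega>. A \<omega> powr (\<kappa> / 2) \<partial>M)"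
    unfolding g_eq using integrable_powr integrable_powr_half expectation_powr
    by (simp add: prob_space)
  moreover have "(\<integral>\<omega>. g \<omega> \<partial>M) > 0"
  proof (rule ccontr)
    assume "\<not> (\<integral>\<omega>. g \<omega> \<partial>M) > 0"
    moreover have "(\<integral>\<omega>. g \<omega> \<partial>M) \<ge> 0" by (intro Bochner_Integration.integral_nonneg) (simp add: g_def)
    ultimately have "(\<integral>\<omega>. g \<omega> \<partial>M) = 0" by simp
    then have "AE \<omega> in M. g \<omega> = 0"
      using int_g by (subst (asm) integral_nonneg_eq_0_iff_AE) (auto simp: g_def)
    then have "AE \<omega> in M. A \<omega> \<noteq> 0 \<longrightarrow> ln (A \<omega>) \<in> lattice_points (2 * h)"
      using A_nonneg
    proof eventually_elim
      case (elim \<omega>)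
      show ?case
      proof
        assume "A \<omega> \<noteq> 0"
        have "\<kappa> / 2 * ln (A \<omega>) = ln (A \<omega> powr (\<kappa> / 2))"
          using \<open>A \<omega> \<noteq> 0\<close> by (simp add: ln_powr)
        also have "\<dots> = 0" using elim by (simp add: g_def)
        finally have "ln (A \<omega>) = 0" using kappa_pos by simp
        then show "ln (A \<omega>) \<in> lattice_points (2 * h)"
          by (auto simp: lattice_points_def intro!: image_eqI[of _ _ 0])
      qed
    qed
    then have "2 * h \<le> h" using h_pos by (intro step_le_span) auto
    then show False using h_pos by simp
  qed
  ultimately show ?thesis by linarith
qed

text \<open>The hypothesis controls only large \<open>A\<close>. Below 1, with
  \<open>t = - ln a\<close>, the bound comes from
  \<open>\<kappa> * t \<le> exp (\<kappa> * t)\<close>. This yields a finite mean for the tilted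
  step.\<close>

lemma powr_times_abs_ln_le:
  assumes "a \<ge> 0"
  shows "a powr \<kappa> * \<bar>ln a\<bar> \<le> a powr \<kappa> * log_plus a + 1 / \<kappa>"
proof (cases "a = 0 \<or> a \<ge> 1")
  case True
  then show ?thesis using kappa_pos by (auto simp: log_plus_def)
next
  case False
  define t where "t = - ln a"
  have t: "t > 0" "a powr \<kappa> = exp (- \<kappa> * t)" using False assms by (auto simp: t_def powr_def)
  have "\<kappa> * t \<le> exp (\<kappa> * t)" using exp_ge_add_one_self[of "\<kappa> * t"] by linarith
  then have "exp (- \<kappa> * t) * (\<kappa> * t) \<le> 1" by (simp add: exp_minus field_simps)
  then have "a powr \<kappa> * t \<le> 1 / \<kappa>" using kappa_pos t by (simp add: field_simps)
  moreover have "\<bar>ln a\<bar> = t" "log_plus a = 0" using t by (auto simp: t_def log_plus_def)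
  ultimately show ?thesis by simp
qed

text \<open>With \<open>l = \<kappa> * h / 2\<close>, the weight \<open>exp (2 * l * j)\<close> is
  the trivial growth bound for the rescaled tail, and \<open>\<rho>\<close> is the half-order moment
  of \<open>A\<close>.\<close>

sublocale tilted: renewal_walk tilted_law "\<kappa> * h / 2" "\<integral>\<omega>. A \<omega> powr (\<kappa> / 2) \<partial>M"
proof
  have *: "AE \<omega> in M. A \<omega> powr \<kappa> * exp (- (\<kappa> * h / 2) * of_int (Z \<omega>)) = A \<omega> powr (\<kappa> / 2)"
    using AE_lattice
  proof eventually_elim
    case (elim \<omega>)
    show ?case using powr_times_exp[OF elim, of "\<kappa> / 2"] by (simp add: algebra_simps)
  qed
  show "integrable (measure_pmf tilted_law) (\<lambda>k. exp (- (\<kappa> * h / 2) * of_int k))"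
    unfolding integrable_tilted_law using integrable_powr_half
    by (subst integrable_cong_AE[OF _ _ *]) auto
  show "(\<integral>k. exp (- (\<kappa> * h / 2) * of_int k) \<partial>measure_pmf tilted_law) = (\<integral>\<omega>. A \<omega> powr (\<kappa> / 2) \<partial>M)"
    unfolding integral_tilted_law by (rule integral_cong_AE[OF _ _ *]) auto
  show "integrable (measure_pmf tilted_law) real_of_int"
    unfolding integrable_tilted_law
  proof (rule Bochner_Integration.integrable_bound)
    show "integrable M (\<lambda>\<omega>. (A \<omega> powr \<kappa> * log_plus (A \<omega>) + 1 / \<kappa>) / h)"
      using integrable_log_plus by simp
    show "AE \<omega> in M. norm (A \<omega> powr \<kappa> * of_int (Z \<omega>)) \<le>
        norm ((A \<omega> powr \<kappa> * log_plus (A \<omega>) + 1 / \<kappa>) / h)"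
      using AE_lattice A_nonneg
    proof eventually_elim
      case (elim \<omega>)
      have "norm (A \<omega> powr \<kappa> * of_int (Z \<omega>)) = A \<omega> powr \<kappa> * \<bar>of_int (Z \<omega>)\<bar>"
        by (simp add: abs_mult)
      also have "\<dots> = A \<omega> powr \<kappa> * \<bar>ln (A \<omega>)\<bar> / h"
      proof (cases "A \<omega> = 0")
        case False
        then have "ln (A \<omega>) = h * of_int (Z \<omega>)" using elim by (metis ln_exp)
        then show ?thesis using h_pos by (simp add: abs_mult)
      qed simp
      also have "\<dots> \<le> (A \<omega> powr \<kappa> * log_plus (A \<omega>) + 1 / \<kappa>) / h"
        using powr_times_abs_ln_le[OF elim(2)] h_pos by (intro divide_right_mono) auto
      also have "\<dots> \<le> norm \<dots>" unfolding real_norm_def by (rule abs_ge_self)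
      finally show ?case .
    qed
  qed simp
  show "Gcd (set_pmf tilted_law) = 1" by (rule Gcd_tilted_law)
qed (use kappa_pos h_pos expectation_powr_half in auto)

text \<open>Full untilting: the moment is the integral of \<open>A powr 0\<close>. Since
  \<open>0 powr 0 = 0\<close>, this is the probability that \<open>A\<close> is nonzero, hence at
  most 1.\<close>

lemma integrable_exp_tilted:
  "integrable (measure_pmf tilted_law) (\<lambda>k. exp (- 2 * (\<kappa> * h / 2) * of_int k))" (is ?int)
  and integral_exp_tilted_le:
  "(\<integral>k. exp (- 2 * (\<kappa> * h / 2) * of_int k) \<partial>measure_pmf tilted_law) \<le> 1" (is ?le)
proof -
  have *: "AE \<omega> in M. A \<omega> powr \<kappa> * exp (- 2 * (\<kappa> * h / 2) * of_int (Z \<omega>)) = A \<omega> powr 0"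
    using AE_lattice
  proof eventually_elim
    case (elim \<omega>)
    show ?case using powr_times_exp[OF elim, of \<kappa>] by (simp add: algebra_simps)
  qed
  have int: "integrable M (\<lambda>\<omega>. A \<omega> powr 0)"
    by (rule integrable_const_bound[where B = 1]) auto
  show ?int
    unfolding integrable_tilted_law using int
    by (subst integrable_cong_AE[OF _ _ *]) auto
  have "(\<integral>k. exp (- 2 * (\<kappa> * h / 2) * of_int k) \<partial>measure_pmf tilted_law) = (\<integral>\<omega>. A \<omega> powr 0 \<partial>M)"
    unfolding integral_tilted_law by (rule integral_cong_AE[OF _ _ *]) auto
  also have "\<dots> \<le> (\<integral>\<omega>. 1 \<partial>M)" by (intro integral_mono int) auto
  finally show ?le by (simp add: prob_space)
qed

theorem tail_convergent:
  assumes indep: "indep_var borel A borel X" and y: "y > 0"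
    and summable: "integrable (count_space UNIV) (\<lambda>j::int. exp (\<kappa> * of_int j * h) *
      (prob {\<omega> \<in> space M. X \<omega> > y * exp (of_int j * h)} -
       prob {\<omega> \<in> space M. A \<omega> * X \<omega> > y * exp (of_int j * h)}))"
  shows "convergent (\<lambda>n::nat. exp (\<kappa> * real n * h) * prob {\<omega> \<in> space M. X \<omega> > y * exp (real n * h)})"
proof -
  have [measurable]: "X \<in> borel_measurable M"
    using indep by (auto simp: indep_var_distribution_eq)
  define r where "r j = exp (\<kappa> * of_int j * h) * prob {\<omega> \<in> space M. X \<omega> > y * exp (of_int j * h)}"
    for j :: int
  define f where "f j = exp (\<kappa> * of_int j * h) *
      (prob {\<omega> \<in> space M. X \<omega> > y * exp (of_int j * h)} -
       prob {\<omega> \<in> space M. A \<omega> * X \<omega> > y * exp (of_int j * h)})" for j :: int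
  have "convergent (\<lambda>n. r (int n))"
  proof (rule tilted.renewal_equation_convergent[OF integrable_exp_tilted integral_exp_tilted_le])
    show "\<bar>r j\<bar> \<le> 1 * exp (2 * (\<kappa> * h / 2) * of_int j)" for j
      by (simp add: r_def abs_mult mult_ac mult_left_le)
    have "filterlim (\<lambda>n. y * exp (h * real n)) at_top sequentially"
      using y h_pos
      by (intro filterlim_tendsto_pos_mult_at_top[OF tendsto_const] filterlim_compose[OF exp_at_top]
          filterlim_real_sequentially) auto
    from tail_tendsto_0[OF _ this, of X]
    have "(\<lambda>n. prob {\<omega> \<in> space M. X \<omega> > y * exp (h * real n)}) \<longlonglongrightarrow> 0" by simp
    moreover have "r (int n) * exp (- 2 * (\<kappa> * h / 2) * real n) =
        prob {\<omega> \<in> space M. X \<omega> > y * exp (h * real n)}" for n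
    proof -
      have "exp (\<kappa> * real n * h) * exp (- 2 * (\<kappa> * h / 2) * real n) = 1"
        by (simp add: exp_add[symmetric])
      then show ?thesis by (simp add: r_def mult_ac)
    qed
    ultimately show "(\<lambda>n. r (int n) * exp (- 2 * (\<kappa> * h / 2) * real n)) \<longlonglongrightarrow> 0" by simp
    show "integrable (count_space UNIV) f" using summable unfolding f_def .
    \<comment> \<open>Given \<open>A = exp (h * Z)\<close>, the weight
      \<open>A powr \<kappa>\<close> restores the factor \<open>exp (\<kappa> * j * h)\<close> and
      the shifted threshold becomes that of \<open>A * X\<close>. Integrating over \<open>A\<close>
      gives the tail of \<open>A * X\<close>.\<close>
    show "r j = f j + step tilted_law r j" for j
    proof -
      have "step tilted_law r j = (\<integral>\<omega>. A \<omega> powr \<kappa> * r (j - Z \<omega>) \<partial>M)"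
        unfolding step_def by (rule integral_tilted_law)
      also have "\<dots> = (\<integral>\<omega>. exp (\<kappa> * of_int j * h) * prob {\<omega>' \<in> space M. A \<omega> * X \<omega>' > y * exp (of_int j * h)} \<partial>M)"
      proof (rule integral_cong_AE)
        show "AE \<omega> in M. A \<omega> powr \<kappa> * r (j - Z \<omega>) =
            exp (\<kappa> * of_int j * h) * prob {\<omega>' \<in> space M. A \<omega> * X \<omega>' > y * exp (of_int j * h)}"
          using AE_lattice
        proof eventually_elim
          case (elim \<omega>)
          show ?case
          proof (cases "A \<omega> = 0")
            case True
            \<comment> \<open>Both sides are 0 where \<open>A\<close> vanishes: the left by
              \<open>0 powr \<kappa> = 0\<close>, the right because the threshold is
              positive.\<close>
            have "\<not> y * exp (of_int j * h) < 0" using y by (simp add: not_less)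
            then show ?thesis using True by simp
          next
            case False
            define z where "z = real_of_int (Z \<omega>)"
            have A: "A \<omega> = exp (h * z)" using False elim by (simp add: z_def)
            have "A \<omega> powr \<kappa> * exp (\<kappa> * (of_int j - z) * h) = exp (\<kappa> * of_int j * h)"
              by (simp add: A powr_def exp_add[symmetric] algebra_simps)
            moreover have "X \<omega>' > y * exp ((of_int j - z) * h) \<longleftrightarrow> A \<omega> * X \<omega>' > y * exp (of_int j * h)" for \<omega>'
            proof -
              have "y * exp (of_int j * h) = A \<omega> * (y * exp ((of_int j - z) * h))"
                by (simp add: A algebra_simps flip: exp_add)
              then show ?thesis by (simp only: A mult_less_cancel_left_pos exp_gt_zero)
            qed
            ultimately show ?thesis by (simp add: r_def z_def mult.assoc[symmetric])
          qed
        qed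
        show "(\<lambda>\<omega>. A \<omega> powr \<kappa> * r (j - Z \<omega>)) \<in> borel_measurable M"
          using measurable_compose[OF Z_measurable, of "\<lambda>k. r (j - k)" borel] by simp
        show "(\<lambda>\<omega>. exp (\<kappa> * of_int j * h) * prob {\<omega>' \<in> space M. A \<omega> * X \<omega>' > y * exp (of_int j * h)})
            \<in> borel_measurable M"
          by (intro borel_measurable_times borel_measurable_const measurable_prob_mult_gt) auto
      qed
      also have "\<dots> = exp (\<kappa> * of_int j * h) * prob {\<omega> \<in> space M. A \<omega> * X \<omega> > y * exp (of_int j * h)}"
        by (simp add: prob_mult_gt_indep[OF indep])
      finally show ?thesis by (simp add: r_def f_def algebra_simps)
    qed
  qed
  then show ?thesis by (simp add: r_def)
qed

end

section \<open>Summability on a dense set, and the limit function\<close>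

text \<open>For \<open>z > 0\<close> the points form a geometric progression of ratio
  \<open>exp h\<close>, and an open interval whose endpoints have ratio at most \<open>exp h\<close>
  contains at most one of them. For other \<open>z\<close> none lies in it.\<close>

lemma nn_integral_scaled_indicator_le:
  fixes a b h z :: real
  assumes a: "a > 0" and h: "h > 0" and b: "b \<le> a * exp h"
  shows "(\<integral>\<^sup>+j. indicator {a<..<b} (z * exp (- of_int j * h)) \<partial>count_space (UNIV :: int set)) \<le> (1 :: ennreal)"
proof -
  have le: "i \<le> j"
    if "z * exp (- of_int i * h) \<in> {a<..<b}" "z * exp (- of_int j * h) \<in> {a<..<b}" for i j :: int
  proof (rule ccontr)
    assume "\<not> i \<le> j"
    then have "of_int j + 1 \<le> (of_int i :: real)" by linarith
    then have "(of_int j + 1) * h \<le> of_int i * h" using h by (intro mult_right_mono) auto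
    then have "exp h * exp (- of_int i * h) \<le> exp (- of_int j * h)"
      by (simp add: exp_add[symmetric] algebra_simps)
    moreover have "z > 0"
      using that(1) a by (metis greaterThanLessThan_iff exp_gt_zero less_trans zero_less_mult_pos2)
    ultimately have "z * (exp h * exp (- of_int i * h)) \<le> z * exp (- of_int j * h)"
      by (intro mult_left_mono) auto
    also have "\<dots> < a * exp h" using that(2) b by simp
    also have "a * exp h < z * exp (- of_int i * h) * exp h"
      using that(1) by (intro mult_strict_right_mono) auto
    finally show False by (simp add: mult_ac)
  qed
  define J where "J = {j :: int. z * exp (- of_int j * h) \<in> {a<..<b}}"
  have "(\<integral>\<^sup>+j. indicator {a<..<b} (z * exp (- of_int j * h)) \<partial>count_space UNIV) =
      (\<integral>\<^sup>+j. indicator J j \<partial>count_space UNIV)"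
    by (intro nn_integral_cong) (auto simp: J_def indicator_def)
  also have "\<dots> = emeasure (count_space UNIV) J" by simp
  also have "\<dots> \<le> 1"
  proof (cases "J = {}")
    case False
    then obtain j where "j \<in> J" by blast
    then have "J = {j}" using le antisym unfolding J_def by blast
    then show ?thesis by (simp add: emeasure_count_space)
  qed simp
  finally show ?thesis .
qed

text \<open>Tonelli on \<open>{a<..<b} \<times> \<int>\<close>: the dilates of a short interval by the powers of \<open>exp h\<close> are
  disjoint, so the geometric sums are finite almost everywhere on the interval.\<close>

lemma exists_summable_dilations:
  fixes D :: "real \<Rightarrow> real"
  assumes [measurable]: "D \<in> borel_measurable borel" and h: "h > 0" and a: "a > 0" and ab: "a < b"
    and int: "set_integrable lborel {0<..} (\<lambda>y. y powr (\<kappa> - 1) * \<bar>D y\<bar>)"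
  shows "\<exists>y. a < y \<and> y < b \<and>
    integrable (count_space UNIV) (\<lambda>j::int. exp (\<kappa> * of_int j * h) * D (y * exp (of_int j * h)))"
proof -
  \<comment> \<open>Shortening the interval to ratio at most \<open>exp h\<close> is what makes its
    dilates disjoint.\<close>
  define b' where "b' = min b (a * exp h)"
  have b': "a < b'" "b' \<le> b" "b' \<le> a * exp h" using ab a h by (auto simp: b'_def)
  define g where "g y = ennreal (indicator {0<..} y * (y powr (\<kappa> - 1) * \<bar>D y\<bar>))" for y
  have [measurable]: "g \<in> borel_measurable borel" unfolding g_def by measurable
  have g_finite: "(\<integral>\<^sup>+y. g y \<partial>lborel) < \<infinity>"
    using int unfolding set_integrable_def integrable_iff_bounded g_def
    by (simp add: abs_mult mult_ac)
  have change: "(\<integral>\<^sup>+y. indicator {a<..<b'} y * (g (y * exp (of_int j * h)) * ennreal (exp (of_int j * h))) \<partial>lborel) =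
      (\<integral>\<^sup>+z. indicator {a<..<b'} (z * exp (- of_int j * h)) * g z \<partial>lborel)" for j :: int
  proof -
    have "(\<integral>\<^sup>+z. indicator {a<..<b'} (z * exp (- of_int j * h)) * g z \<partial>lborel) =
        ennreal \<bar>exp (of_int j * h)\<bar> * (\<integral>\<^sup>+y. indicator {a<..<b'} ((0 + exp (of_int j * h) * y) * exp (- of_int j * h))
          * g (0 + exp (of_int j * h) * y) \<partial>lborel)"
      by (rule nn_integral_real_affine) auto
    also have "\<dots> = ennreal (exp (of_int j * h)) * (\<integral>\<^sup>+y. indicator {a<..<b'} y * g (y * exp (of_int j * h)) \<partial>lborel)"
    proof -
      have "(0 + exp (of_int j * h) * y) * exp (- of_int j * h) = y" for y
        by (simp add: exp_minus field_simps)
      then show ?thesis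
        by (simp only: abs_exp_cancel add_0_left mult.commute[of "exp (of_int j * h)"])
    qed
    also have "\<dots> = (\<integral>\<^sup>+y. ennreal (exp (of_int j * h)) * (indicator {a<..<b'} y * g (y * exp (of_int j * h))) \<partial>lborel)"
      by (rule nn_integral_cmult[symmetric]) measurable
    finally show ?thesis by (simp add: mult_ac)
  qed
  define s where "s y = (\<integral>\<^sup>+j. g (y * exp (of_int j * h)) * ennreal (exp (of_int j * h)) \<partial>count_space (UNIV :: int set))" for y
  have "(\<integral>\<^sup>+y. indicator {a<..<b'} y * s y \<partial>lborel) =
      (\<integral>\<^sup>+y. (\<integral>\<^sup>+j. indicator {a<..<b'} y * (g (y * exp (of_int j * h)) * ennreal (exp (of_int j * h)))
        \<partial>count_space (UNIV :: int set)) \<partial>lborel)"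
    unfolding s_def by (intro nn_integral_cong nn_integral_cmult[symmetric]) auto
  also have "\<dots> = (\<integral>\<^sup>+j. (\<integral>\<^sup>+y. indicator {a<..<b'} y * (g (y * exp (of_int j * h)) * ennreal (exp (of_int j * h)))
        \<partial>lborel) \<partial>count_space (UNIV :: int set))"
    by (rule nn_integral_count_space_nn_integral) (auto intro!: countableI_type)
  also have "\<dots> = (\<integral>\<^sup>+z. (\<integral>\<^sup>+j. indicator {a<..<b'} (z * exp (- of_int j * h)) * g z \<partial>count_space (UNIV :: int set)) \<partial>lborel)"
    unfolding change
    by (rule nn_integral_count_space_nn_integral[symmetric]) (auto intro!: countableI_type)
  also have "\<dots> \<le> (\<integral>\<^sup>+z. g z \<partial>lborel)"
  proof (rule nn_integral_mono)
    fix z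
    have "(\<integral>\<^sup>+j. indicator {a<..<b'} (z * exp (- of_int j * h)) * g z \<partial>count_space (UNIV :: int set)) =
        (\<integral>\<^sup>+j. indicator {a<..<b'} (z * exp (- of_int j * h)) \<partial>count_space (UNIV :: int set)) * g z"
      by (rule nn_integral_multc) auto
    also have "\<dots> \<le> 1 * g z"
      using a h b'(3) by (intro mult_right_mono nn_integral_scaled_indicator_le) auto
    finally show "(\<integral>\<^sup>+j. indicator {a<..<b'} (z * exp (- of_int j * h)) * g z \<partial>count_space (UNIV :: int set)) \<le> g z"
      by simp
  qed
  finally have fin: "(\<integral>\<^sup>+y. indicator {a<..<b'} y * s y \<partial>lborel) \<noteq> \<infinity>"
    using g_finite by (metis infinity_ennreal_def less_le_not_le top_greatest)
  have [measurable]: "s \<in> borel_measurable borel"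
    unfolding s_def
  proof (rule sigma_finite_measure.borel_measurable_nn_integral[OF sigma_finite_measure_count_space])
    show "(\<lambda>(y, j). g (y * exp (of_int j * h)) * ennreal (exp (of_int j * h)))
        \<in> borel_measurable (borel \<Otimes>\<^sub>M count_space (UNIV :: int set))"
      by measurable
  qed
  have finite_AE: "AE y in lborel. indicator {a<..<b'} y * s y \<noteq> \<infinity>"
    by (rule nn_integral_PInf_AE[OF _ fin]) auto
  have "\<exists>y. y \<in> {a<..<b'} \<and> s y \<noteq> \<infinity>"
  proof (rule ccontr)
    assume *: "\<nexists>y. y \<in> {a<..<b'} \<and> s y \<noteq> \<infinity>"
    have "AE y in lborel. y \<notin> {a<..<b'}"
      using finite_AE
    proof eventually_elim
      case (elim y)
      show "y \<notin> {a<..<b'}"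
      proof
        assume "y \<in> {a<..<b'}"
        then show False using elim * by simp
      qed
    qed
    then show False
      using b'(1) by (subst (asm) AE_iff_measurable[of "{a<..<b'}"]) auto
  qed
  then obtain y where y: "y \<in> {a<..<b'}" "s y \<noteq> \<infinity>" by blast
  \<comment> \<open>At a fixed \<open>y\<close> the Jacobian \<open>exp (j * h)\<close> raises the
    exponent from \<open>\<kappa> - 1\<close> to \<open>\<kappa>\<close>, leaving the positive
    constant \<open>c\<close>.\<close>
  define c where "c = y powr (\<kappa> - 1)"
  have y_pos: "y > 0" and c: "c > 0" using y(1) a by (auto simp: c_def)
  have "s y = (\<integral>\<^sup>+j. ennreal c * ennreal (norm (exp (\<kappa> * of_int j * h) * D (y * exp (of_int j * h)))) \<partial>count_space (UNIV :: int set))"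
    unfolding s_def
  proof (rule nn_integral_cong)
    fix j :: int
    have "(y * exp (of_int j * h)) powr (\<kappa> - 1) * exp (of_int j * h) = c * exp (\<kappa> * of_int j * h)"
    proof -
      have "exp (of_int j * h) powr (\<kappa> - 1) * exp (of_int j * h) = exp (\<kappa> * of_int j * h)"
        by (simp add: powr_def exp_add[symmetric] algebra_simps)
      then show ?thesis using y_pos by (simp add: c_def powr_mult mult.assoc)
    qed
    then have "(y * exp (of_int j * h)) powr (\<kappa> - 1) * \<bar>D (y * exp (of_int j * h))\<bar> * exp (of_int j * h) =
        c * (exp (\<kappa> * of_int j * h) * \<bar>D (y * exp (of_int j * h))\<bar>)"
      by (simp add: mult_ac)
    then show "g (y * exp (of_int j * h)) * ennreal (exp (of_int j * h)) =
        ennreal c * ennreal (norm (exp (\<kappa> * of_int j * h) * D (y * exp (of_int j * h))))"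
      using y_pos c by (simp add: g_def abs_mult ennreal_mult'[symmetric])
  qed
  also have "\<dots> = ennreal c * (\<integral>\<^sup>+j. ennreal (norm (exp (\<kappa> * of_int j * h) * D (y * exp (of_int j * h)))) \<partial>count_space (UNIV :: int set))"
    by (rule nn_integral_cmult) auto
  finally have "(\<integral>\<^sup>+j. ennreal (norm (exp (\<kappa> * of_int j * h) * D (y * exp (of_int j * h)))) \<partial>count_space (UNIV :: int set)) < \<infinity>"
    using y(2) c by (auto simp: ennreal_mult_eq_top_iff less_top)
  then have "integrable (count_space UNIV) (\<lambda>j::int. exp (\<kappa> * of_int j * h) * D (y * exp (of_int j * h)))"
    by (intro integrableI_bounded) auto
  then show ?thesis using y(1) b'(2) by auto
qed

text \<open>The lower limit exists at every point, inherits monotonicity and the scaling relation,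
  and equals the limit wherever there is one. It is finite because some point of convergence lies to
  the left.\<close>

lemma monotone_liminf_limit:
  fixes F :: "nat \<Rightarrow> real \<Rightarrow> real"
  assumes nonneg: "\<And>n x. F n x \<ge> 0"
    and anti: "\<And>n x y. x \<le> y \<Longrightarrow> F n y \<le> F n x"
    and shift: "\<And>n x. F n (x * exp h) = exp (- \<kappa> * h) * F (Suc n) x"
    and dense: "\<And>a b. 0 < a \<Longrightarrow> a < b \<Longrightarrow> \<exists>y. a < y \<and> y < b \<and> convergent (\<lambda>n. F n y)"
  obtains \<Phi> :: "real \<Rightarrow> real" where
    "\<And>x. \<Phi> x \<ge> 0" "\<And>x y. 0 < x \<Longrightarrow> x \<le> y \<Longrightarrow> \<Phi> y \<le> \<Phi> x"
    "\<And>x. 0 < x \<Longrightarrow> \<Phi> (x * exp h) = exp (- \<kappa> * h) * \<Phi> x"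
    "\<And>x. convergent (\<lambda>n. F n x) \<Longrightarrow> (\<lambda>n. F n x) \<longlonglongrightarrow> \<Phi> x"
    "\<And>x. 0 < x \<Longrightarrow> isCont \<Phi> x \<Longrightarrow> (\<lambda>n. F n x) \<longlonglongrightarrow> \<Phi> x"
proof
  define G where "G x = liminf (\<lambda>n. ereal (F n x))" for x
  define \<Phi> where "\<Phi> x = real_of_ereal (G x)" for x
  have G_nonneg: "G x \<ge> 0" for x
    unfolding G_def by (intro Liminf_bounded) (simp add: nonneg)
  have G_anti: "G y \<le> G x" if "x \<le> y" for x y
    unfolding G_def using anti[OF that] by (intro Liminf_mono) simp
  have G_lim: "G x = ereal c" if "(\<lambda>n. F n x) \<longlonglongrightarrow> c" for x c
    unfolding G_def using that by (intro lim_imp_Liminf) auto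
  have G_finite: "G x < \<infinity>" if x: "x > 0" for x
  proof -
    obtain z where "z < x" "convergent (\<lambda>n. F n z)" using dense[of "x / 2" x] x by auto
    then obtain c where "G z = ereal c" using G_lim by (auto simp: convergent_def)
    then show ?thesis using G_anti[of z x] \<open>z < x\<close> by (auto intro: le_less_trans)
  qed
  have G_eq: "G x = ereal (\<Phi> x)" if "x > 0" for x
    using G_finite[OF that] G_nonneg[of x] by (auto simp: \<Phi>_def ereal_real')
  show "\<Phi> x \<ge> 0" for x
    unfolding \<Phi>_def using G_nonneg by (rule real_of_ereal_pos)
  show \<Phi>_anti: "\<Phi> y \<le> \<Phi> x" if "0 < x" "x \<le> y" for x y
    using G_anti[OF that(2)] G_eq[of x] G_eq[of y] that by simp
  show "\<Phi> (x * exp h) = exp (- \<kappa> * h) * \<Phi> x" if "0 < x" for x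
  proof -
    have "G (x * exp h) = liminf (\<lambda>n. ereal (exp (- \<kappa> * h)) * ereal (F (Suc n) x))"
      by (simp add: G_def shift)
    also have "\<dots> = ereal (exp (- \<kappa> * h)) * liminf (\<lambda>n. ereal (F (Suc n) x))"
      by (rule Liminf_ereal_mult_left) auto
    also have "liminf (\<lambda>n. ereal (F (Suc n) x)) = G x"
      unfolding G_def using liminf_shift[of "\<lambda>n. ereal (F n x)"] by simp
    finally show ?thesis using that by (simp add: G_eq)
  qed
  show lim: "(\<lambda>n. F n x) \<longlonglongrightarrow> \<Phi> x" if "convergent (\<lambda>n. F n x)" for x
  proof -
    from that obtain c where c: "(\<lambda>n. F n x) \<longlonglongrightarrow> c" by (auto simp: convergent_def)
    then have "\<Phi> x = c" by (simp add: \<Phi>_def G_lim)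
    then show ?thesis using c by simp
  qed
  show "(\<lambda>n. F n x) \<longlonglongrightarrow> \<Phi> x" if x: "0 < x" and cont: "isCont \<Phi> x" for x
  proof (rule order_tendstoI)
    fix l assume "l < \<Phi> x"
    then have "ereal l < liminf (\<lambda>n. ereal (F n x))" using G_eq[OF x] by (simp add: G_def)
    from less_LiminfD[OF this] show "\<forall>\<^sub>F n in sequentially. l < F n x" by simp
  next
    \<comment> \<open>The lower limit gives only the lower estimate. For the upper one, continuity
      and density supply a point of convergence \<open>y < x\<close> with
      \<open>\<Phi> y < u\<close>, and \<open>F n x \<le> F n y\<close>.\<close>
    fix u assume "\<Phi> x < u"
    with cont have "\<forall>\<^sub>F y in at x. \<Phi> y < u" unfolding isCont_def by (rule order_tendstoD)
    then have "\<forall>\<^sub>F y in at_left x. \<Phi> y < u" by (rule filter_leD[OF at_le, rotated]) simp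
    then obtain a where a: "a < x" "\<And>y. a < y \<Longrightarrow> y < x \<Longrightarrow> \<Phi> y < u"
      unfolding eventually_at_left_field by auto
    obtain y where y: "max a (x / 2) < y" "y < x" "convergent (\<lambda>n. F n y)"
      using dense[of "max a (x / 2)" x] a(1) x by (auto simp: less_max_iff_disj)
    have "\<Phi> y < u" using a(2) y by simp
    with lim[OF y(3)] have "\<forall>\<^sub>F n in sequentially. F n y < u" by (rule order_tendstoD)
    then show "\<forall>\<^sub>F n in sequentially. F n x < u"
      by eventually_elim (use anti[of y x] y(2) in \<open>auto intro: le_less_trans\<close>)
  qed
qed

theorem theorem1:
  fixes M :: "'a measure" and A X :: "'a \<Rightarrow> real" and \<kappa> h :: real
  assumes "prob_space M"
    and "\<kappa> > 0" and "h > 0"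
    and "A \<in> borel_measurable M" and "X \<in> borel_measurable M"
    and "AE \<omega> in M. A \<omega> \<ge> 0"
    and "integrable M (\<lambda>\<omega>. A \<omega> powr \<kappa>)" and "(\<integral>\<omega>. A \<omega> powr \<kappa> \<partial>M) = 1"
    and "integrable M (\<lambda>\<omega>. A \<omega> powr \<kappa> * log_plus (A \<omega>))"
    and "arithmetic (cond_log_distr M A)" and "has_arithmetic_span (cond_log_distr M A) h"
    and "prob_space.indep_var M borel A borel X"
    and "set_integrable lborel {0<..}
      (\<lambda>y. y powr (\<kappa> - 1) * \<bar>\<P>(\<omega> in M. X \<omega> > y) - \<P>(\<omega> in M. A \<omega> * X \<omega> > y)\<bar>)"
  shows "\<exists>q \<in> Q_class \<kappa> h.
    (\<forall>x \<in> continuity_points {0<..} q.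
      (\<lambda>n::nat. x powr \<kappa> * exp (\<kappa> * real n * h) * \<P>(\<omega> in M. X \<omega> > x * exp (real n * h)))
        \<longlonglongrightarrow> q x) \<and>
    ((\<forall>x::real. (\<lambda>j::int. exp (\<kappa> * (x + of_int j * h)) *
         \<bar>\<P>(\<omega> in M. X \<omega> > exp (x + of_int j * h)) - \<P>(\<omega> in M. A \<omega> * X \<omega> > exp (x + of_int j * h))\<bar>)
         summable_on UNIV) \<longrightarrow>
     (\<forall>x>0.
      (\<lambda>n::nat. x powr \<kappa> * exp (\<kappa> * real n * h) * \<P>(\<omega> in M. X \<omega> > x * exp (real n * h)))
        \<longlonglongrightarrow> q x))"
proof -
  interpret arithmetic_tilt M A \<kappa> h
    by (intro arithmetic_tilt.intro arithmetic_tilt_axioms.intro assms)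
  have [measurable]: "X \<in> borel_measurable M" by fact
  define D where "D y = \<P>(\<omega> in M. X \<omega> > y) - \<P>(\<omega> in M. A \<omega> * X \<omega> > y)" for y
  have [measurable]: "D \<in> borel_measurable borel"
    unfolding D_def prob_eq_integral_if by measurable
  \<comment> \<open>The factor \<open>x powr \<kappa>\<close> is left out so that each
    \<open>F n\<close> is nonincreasing; it returns in \<open>q\<close>, where it turns the scaling
    relation of \<open>\<Phi>\<close> into periodicity.\<close>
  define F where "F n x = exp (\<kappa> * real n * h) * \<P>(\<omega> in M. X \<omega> > x * exp (real n * h))" for n x
  have conv: "convergent (\<lambda>n. F n y)"
    if "y > 0" "integrable (count_space UNIV) (\<lambda>j::int. exp (\<kappa> * of_int j * h) * D (y * exp (of_int j * h)))" for y
    using tail_convergent[OF assms(12) that(1)] that(2) by (simp add: F_def D_def)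
  have "F n y \<le> F n x" if "x \<le> y" for n x y
    unfolding F_def using that
    by (intro mult_left_mono finite_measure_mono) (auto intro: le_less_trans[OF mult_right_mono])
  moreover have "F n (x * exp h) = exp (- \<kappa> * h) * F (Suc n) x" for n x
  proof -
    have "exp (- \<kappa> * h) * exp (\<kappa> * real (Suc n) * h) = exp (\<kappa> * real n * h)"
      by (simp add: exp_add[symmetric] algebra_simps)
    moreover have "x * exp h * exp (real n * h) = x * exp (real (Suc n) * h)"
      by (simp add: exp_add[symmetric] algebra_simps)
    ultimately show ?thesis by (simp only: F_def mult.assoc[symmetric])
  qed
  moreover have "\<exists>y. a < y \<and> y < b \<and> convergent (\<lambda>n. F n y)" if "0 < a" "a < b" for a b
    using exists_summable_dilations[of D h a b \<kappa>] conv that h_pos assms(13)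
    by (fastforce simp: D_def[symmetric])
  ultimately obtain \<Phi> where \<Phi>_nonneg: "\<And>x. \<Phi> x \<ge> 0"
    and \<Phi>_anti: "\<And>x y. 0 < x \<Longrightarrow> x \<le> y \<Longrightarrow> \<Phi> y \<le> \<Phi> x"
    and \<Phi>_shift: "\<And>x. 0 < x \<Longrightarrow> \<Phi> (x * exp h) = exp (- \<kappa> * h) * \<Phi> x"
    and \<Phi>_conv: "\<And>x. convergent (\<lambda>n. F n x) \<Longrightarrow> (\<lambda>n. F n x) \<longlonglongrightarrow> \<Phi> x"
    and \<Phi>_cont: "\<And>x. 0 < x \<Longrightarrow> isCont \<Phi> x \<Longrightarrow> (\<lambda>n. F n x) \<longlonglongrightarrow> \<Phi> x"
    by (rule monotone_liminf_limit[of F h \<kappa>, rotated 1]) (auto simp: F_def)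
  define q where "q x = x powr \<kappa> * \<Phi> x" for x
  have \<Phi>_eq: "x powr (- \<kappa>) * q x = \<Phi> x" if "x > 0" for x
    using that by (simp add: q_def powr_minus)
  have lim: "(\<lambda>n. x powr \<kappa> * exp (\<kappa> * real n * h) * \<P>(\<omega> in M. X \<omega> > x * exp (real n * h))) \<longlonglongrightarrow> q x"
    if "(\<lambda>n. F n x) \<longlonglongrightarrow> \<Phi> x" for x
    using tendsto_mult[OF tendsto_const[of "x powr \<kappa>"] that] by (simp add: q_def F_def mult.assoc)
  show ?thesis
  proof (intro bexI[of _ q] conjI ballI impI allI)
    have "q (x * exp h) = q x" if "x > 0" for x
    proof -
      have "exp h powr \<kappa> * exp (- \<kappa> * h) = 1" by (simp add: powr_def exp_add[symmetric])
      then show ?thesis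
        using that by (simp add: q_def \<Phi>_shift powr_mult)
    qed
    then show "q \<in> Q_class \<kappa> h"
      using \<Phi>_nonneg \<Phi>_anti by (auto simp: Q_class_def \<Phi>_eq monotone_on_def) (simp add: q_def)
  next
    fix x assume "x \<in> continuity_points {0<..} q"
    then have x: "x > 0" and "continuous (at x within {0<..}) q" by (auto simp: continuity_points_def)
    \<comment> \<open>The half-line is open, so relative continuity is ordinary continuity, and
      multiplication by \<open>x powr (- \<kappa>)\<close> transfers it to \<open>\<Phi>\<close>
      near \<open>x\<close>.\<close>
    then have "isCont q x" by (simp add: at_within_open[of x "{0<..}"])
    then have "isCont (\<lambda>x. x powr (- \<kappa>) * q x) x" using x by (intro continuous_intros) auto
    moreover have "\<forall>\<^sub>F z in nhds x. z powr (- \<kappa>) * q z = \<Phi> z"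
      using eventually_nhds_in_open[of "{0<..}" x] x by (auto elim!: eventually_mono simp: \<Phi>_eq)
    ultimately have "isCont \<Phi> x" by (subst (asm) isCont_cong)
    then show "(\<lambda>n. x powr \<kappa> * exp (\<kappa> * real n * h) * \<P>(\<omega> in M. X \<omega> > x * exp (real n * h))) \<longlonglongrightarrow> q x"
      by (intro lim \<Phi>_cont x)
  next
    fix x :: real
    assume sum: "\<forall>x::real. (\<lambda>j::int. exp (\<kappa> * (x + of_int j * h)) *
         \<bar>\<P>(\<omega> in M. X \<omega> > exp (x + of_int j * h)) - \<P>(\<omega> in M. A \<omega> * X \<omega> > exp (x + of_int j * h))\<bar>)
         summable_on UNIV" and x: "x > 0"
    \<comment> \<open>The hypothesis is in logarithmic scale, so it is used at \<open>ln x\<close>;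
      it differs from the series required by \<open>conv\<close> by the constant
      \<open>x powr \<kappa>\<close>. Unconditional summability then passes to integrability for
      counting measure.\<close>
    have "exp (\<kappa> * (ln x + of_int j * h)) * \<bar>D (exp (ln x + of_int j * h))\<bar> =
        x powr \<kappa> * norm (exp (\<kappa> * of_int j * h) * D (x * exp (of_int j * h)))" for j :: int
      using x by (simp add: exp_add powr_def abs_mult algebra_simps)
    with sum[rule_format, of "ln x"]
    have "(\<lambda>j::int. x powr \<kappa> * norm (exp (\<kappa> * of_int j * h) * D (x * exp (of_int j * h)))) summable_on UNIV"
      unfolding D_def[symmetric] by simp
    then have "(\<lambda>j::int. norm (exp (\<kappa> * of_int j * h) * D (x * exp (of_int j * h)))) summable_on UNIV"
      using x by (subst (asm) summable_on_cmult_right') auto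
    then have "integrable (count_space UNIV) (\<lambda>j::int. exp (\<kappa> * of_int j * h) * D (x * exp (of_int j * h)))"
      unfolding abs_summable_equivalent abs_summable_on_def .
    then show "(\<lambda>n. x powr \<kappa> * exp (\<kappa> * real n * h) * \<P>(\<omega> in M. X \<omega> > x * exp (real n * h))) \<longlonglongrightarrow> q x"
      by (intro lim \<Phi>_conv conv x)
  qed
qed

end
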